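(* Let $n\in\mathbb{N}$, $r\in\mathbb{N}\cup\{0\}$, and let $p,q\ge 1$ be such that either (i) $p\ge q$ and $\frac1q-\frac1p<\frac1n$, or (ii) $p<q$. Let $\omega$ be a smooth $r$-form on a convex set $D\subset\mathbb{R}^n$. Then there exists an $r$-form $\xi$ on $D$ such that $d\omega=d\xi$ and $$\|\xi\|_{L^p(D)}\le c\,\|d\omega\|_{L^q(D)},\qquad c:=\mathrm{Vol}(D)^{\frac1p-\frac1q}\,C(p,q,r,n)\,R,$$ where $R$ is the diameter of $D$ and $$C(p,q,r,n):=\begin{cases}\displaystyle\int_0^1\min\big(t^{n/p},(1-t)^{n/p}\big)\,t^{r-n/p}(1-t)^{-n/q}\,dt & \text{in case (i)},\\[2mm] \displaystyle\int_0^1\min\big(t^{n/q},(1-t)^{n/q}\big)\,t^{r-n/q}(1-t)^{-n/q}\,dt & \text{in case (ii)}.\end{cases}$$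
   Context: $\mathrm{Vol}$ is $n$-dimensional volume in $\mathbb{R}^n$. For a form $\alpha$ on $D$, $\|\alpha\|_{L^p(D)}=\left(\int_D|\alpha(x)|^p\,dx\right)^{1/p}$, where $|\alpha(x)|$ is the pointwise norm of $\alpha$ at $x$; $d$ is the exterior derivative. *)

theory Defs
  imports "HOL-Analysis.Analysis"
begin

text \<open>
  An \<open>r\<close>-covector is an alternating multilinear map of \<open>r\<close> vectors, the arguments being given as
  a list of length \<open>r\<close>.  It is normalised to be \<open>0\<close> on lists of any other length, so that equality
  of covectors is equality of functions.
\<close>

definition covector :: "nat \<Rightarrow> ('a::real_vector list \<Rightarrow> real) \<Rightarrow> bool" where
  "covector r \<alpha> \<longleftrightarrow>
     (\<forall>vs i. length vs = r \<and> i < r \<longrightarrow> linear (\<lambda>v. \<alpha> (vs[i := v]))) \<and>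
     (\<forall>vs. length vs = r \<and> \<not> distinct vs \<longrightarrow> \<alpha> vs = 0) \<and>
     (\<forall>vs. length vs \<noteq> r \<longrightarrow> \<alpha> vs = 0)"

text \<open>
  The Euclidean norm for which the forms \<open>dx\<^sub>I\<close>, \<open>I = (i\<^sub>1 < \<dots> < i\<^sub>r)\<close>, are orthonormal.  The sum
  runs over all \<open>r\<close>-tuples of basis vectors; each increasing tuple is counted \<open>r!\<close> times, and
  tuples with a repeated entry contribute \<open>0\<close>.
\<close>

definition covector_norm :: "nat \<Rightarrow> ('a::euclidean_space list \<Rightarrow> real) \<Rightarrow> real" where
  "covector_norm r \<alpha> =
     sqrt ((\<Sum>es \<in> {es. length es = r \<and> set es \<subseteq> Basis}. (\<alpha> es)\<^sup>2) / fact r)"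

type_synonym 'a form = "'a \<Rightarrow> 'a list \<Rightarrow> real"

text \<open>Meant for open \<open>U\<close>.\<close>

primrec Ck_on :: "nat \<Rightarrow> 'a::real_normed_vector set \<Rightarrow> ('a \<Rightarrow> real) \<Rightarrow> bool" where
  "Ck_on 0 U f \<longleftrightarrow> continuous_on U f"
| "Ck_on (Suc k) U f \<longleftrightarrow>
     (\<forall>x\<in>U. f differentiable (at x)) \<and> (\<forall>v. Ck_on k U (\<lambda>x. frechet_derivative f (at x) v))"

text \<open>
  Smoothness on an arbitrary set \<open>D\<close> is smoothness on some open neighbourhood of \<open>D\<close>; for open
  \<open>D\<close> this is smoothness on \<open>D\<close> itself.
\<close>

definition smooth_form_on :: "nat \<Rightarrow> 'a::real_normed_vector set \<Rightarrow> 'a form \<Rightarrow> bool" where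
  "smooth_form_on r D \<omega> \<longleftrightarrow>
     (\<exists>U. open U \<and> D \<subseteq> U \<and> (\<forall>x\<in>U. covector r (\<omega> x)) \<and>
          (\<forall>vs k. length vs = r \<longrightarrow> Ck_on k U (\<lambda>x. \<omega> x vs)))"

text \<open>
  \<open>d\<omega>(v\<^sub>0, \<dots>, v\<^sub>r) = \<Sum>\<^sub>i (-1)\<^sup>i D\<omega>[v\<^sub>i](v\<^sub>0, \<dots>, v\<^sub>i omitted, \<dots>, v\<^sub>r)\<close>, which for
  \<open>\<omega> = \<Sum>\<^sub>I \<omega>\<^sub>I dx\<^sub>I\<close> is \<open>\<Sum>\<^sub>I d\<omega>\<^sub>I \<and> dx\<^sub>I\<close>.
\<close>

definition ext_deriv :: "'a::real_normed_vector form \<Rightarrow> 'a form" where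
  "ext_deriv \<omega> x vs =
     (\<Sum>i<length vs. (-1) ^ i *
        frechet_derivative (\<lambda>y. \<omega> y (take i vs @ drop (Suc i) vs)) (at x) (vs ! i))"

text \<open>
  The value is \<open>\<infinity>\<close> if the integral diverges.  Lebesgue rather than Borel measure is
  used since a convex set need not be Borel.
\<close>

definition Lp_norm :: "real \<Rightarrow> nat \<Rightarrow> 'a::euclidean_space set \<Rightarrow> 'a form \<Rightarrow> ennreal" where
  "Lp_norm p r D \<alpha> =
     (let I = (\<integral>\<^sup>+x\<in>D. ennreal (covector_norm r (\<alpha> x) powr p) \<partial>lebesgue)
      in if I = \<infinity> then \<infinity> else ennreal (enn2real I powr (1 / p)))"

text \<open>
  Under the hypotheses on \<open>p\<close>, \<open>q\<close> the integrand is bounded by a constant multiple of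
  \<open>(1 - t)\<^sup>-\<^sup>s\<close> with \<open>s < 1\<close>, so the integral converges.
\<close>

definition Cconst :: "real \<Rightarrow> real \<Rightarrow> nat \<Rightarrow> nat \<Rightarrow> real" where
  "Cconst p q r n =
     (if p \<ge> q
      then integral {0..1} (\<lambda>t. min (t powr (real n / p)) ((1 - t) powr (real n / p))
                                * t powr (real r - real n / p) * (1 - t) powr (- (real n / q)))
      else integral {0..1} (\<lambda>t. min (t powr (real n / q)) ((1 - t) powr (real n / q))
                                * t powr (real r - real n / q) * (1 - t) powr (- (real n / q))))"

end

theory Submission
  imports Defs
begin

text \<open>
  For \<open>y \<in> D\<close> the cone operator
  \<open>(\<kappa>\<^sub>y \<alpha>)(x) = \<integral>\<^sub>0\<^sup>1 t\<^sup>r \<alpha>(y + t(x - y))(x - y, \<dots>) dt\<close> satisfies \<open>d(\<kappa>\<^sub>y d\<omega>) = d\<omega>\<close>.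
  Averaging over \<open>y \<in> D\<close> gives the constant: by Jensen's inequality with the weight that is the
  integrand of \<open>C(p,q,r,n)\<close>, the \<open>L\<^sup>p\<close> bound reduces to a bound for each \<open>t\<close>, where Jensen's
  inequality in \<open>y\<close> and the substitutions \<open>z = y + t(x - y)\<close> in \<open>x\<close> or in \<open>y\<close> apply.
  The case \<open>p < q\<close> follows from \<open>p = q\<close> by Hoelder's inequality.

  The average over all of \<open>D\<close> need not be smooth, since \<open>d\<omega>\<close> is not controlled near the
  boundary of \<open>D\<close>.  Averaging over a compact \<open>K\<close> inside the interior of \<open>D\<close> is smooth near \<open>D\<close>,
  but its norm may exceed the average over \<open>D\<close> by a factor \<open>Vol D / Vol K\<close>.  This loss is absorbed
  because the bound \<open>|x - y| \<le> R\<close> used for the average over \<open>D\<close> is strict for interior \<open>x\<close>, which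
  makes the estimate for \<open>D\<close> strict unless its left-hand side vanishes.
\<close>

subsection \<open>Smooth functions and symmetry of second derivatives\<close>

text \<open>For fixed t let H(x) be the integral of |d\<omega>|^q at y + t(x - y) over y in D.
  Substitution in y gives H \<le> (1-t)^(-n) N, where N is the integral of |d\<omega>|^q over D.
  This sup bound raises the exponent from q to p at the price (1-t)^(-n(1/q - 1/p)), which 1/q - 1/p
  < 1/n makes integrable at t = 1. The integral of H over x is then bounded with the factor t^(-n)
  or (1-t)^(-n), according to the variable substituted. Either factor alone may be too singular at
  one end of [0,1]; taking the smaller one for each t produces the minimum in C. The factor t^r is
  that of the cone operator on (r+1)-forms.

  Compactness of K serves the smoothness: the points whose segments to K stay inside a given
  neighbourhood of D form an open set, which contains D because D is convex. So the average is
  smooth near boundary points of D too. K depends on \<omega>, the constant does not.\<close>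

lemma frechet_derivative_eqI:
  "(f has_derivative f') (at x) \<Longrightarrow> frechet_derivative f (at x) = f'"
  using frechet_derivative_at by metis

lemma Ck_on_SucD: "Ck_on (Suc k) U f \<Longrightarrow> Ck_on k U f"
proof (induction k arbitrary: f)
  case 0
  then show ?case
    by (auto intro!: continuous_at_imp_continuous_on differentiable_imp_continuous_within)
next
  case (Suc k)
  have "Ck_on k U (\<lambda>x. frechet_derivative f (at x) v)" for v
    by (rule Suc.IH) (use Suc.prems in simp)
  then show ?case using Suc.prems by (simp only: Ck_on.simps) blast
qed

lemma Ck_on_cong:
  assumes "open U" "\<And>x. x \<in> U \<Longrightarrow> f x = g x" "Ck_on k U f"
  shows "Ck_on k U g"
  using assms(2,3)
proof (induction k arbitrary: f g)
  case 0
  then show ?case using continuous_on_cong by force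
next
  case (Suc k)
  have d: "(f has_derivative frechet_derivative f (at x)) (at x)" if "x \<in> U" for x
    using Suc.prems(2) that frechet_derivative_works by auto
  have dg: "(g has_derivative frechet_derivative f (at x)) (at x)" if "x \<in> U" for x
    using has_derivative_transform_within_open[OF d[OF that] \<open>open U\<close> that] Suc.prems(1) by blast
  have eq: "frechet_derivative f (at x) = frechet_derivative g (at x)" if "x \<in> U" for x
    using frechet_derivative_eqI[OF dg[OF that]] by simp
  show ?case
  proof (simp, intro conjI ballI allI)
    show "g differentiable at x" if "x \<in> U" for x
      using dg[OF that] differentiableI by blast
    show "Ck_on k U (\<lambda>x. frechet_derivative g (at x) v)" for v
      by (rule Suc.IH[of "\<lambda>x. frechet_derivative f (at x) v"]) (use Suc.prems eq in auto)
  qed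
qed

lemma Ck_on_SucI:
  assumes "open U" "\<And>x. x \<in> U \<Longrightarrow> (f has_derivative f' x) (at x)"
    "\<And>v. Ck_on k U (\<lambda>x. f' x v)"
  shows "Ck_on (Suc k) U f"
proof (simp, intro conjI ballI allI)
  show "f differentiable at x" if "x \<in> U" for x
    using assms(2)[OF that] differentiableI by blast
  show "Ck_on k U (\<lambda>x. frechet_derivative f (at x) v)" for v
    by (rule Ck_on_cong[OF assms(1) _ assms(3)[of v]])
      (use frechet_derivative_eqI[OF assms(2)] in auto)
qed

lemma Ck_on_has_derivative:
  assumes "Ck_on (Suc k) U f" "x \<in> U"
  shows "(f has_derivative frechet_derivative f (at x)) (at x)"
  using assms frechet_derivative_works by auto

lemma Ck_on_frechet_derivative:
  "Ck_on (Suc k) U f \<Longrightarrow> Ck_on k U (\<lambda>x. frechet_derivative f (at x) v)"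
  by simp

lemma Ck_on_continuous: "Ck_on k U f \<Longrightarrow> continuous_on U f"
proof (induction k)
  case (Suc k)
  then show ?case using Ck_on_SucD by blast
qed simp

lemma Ck_on_const: "open U \<Longrightarrow> Ck_on k U (\<lambda>x. c)"
proof (induction k arbitrary: c)
  case (Suc k)
  show ?case
    by (rule Ck_on_SucI[where f' = "\<lambda>_ _. 0"]) (use Suc in auto)
qed simp

lemma Ck_on_inner_right: "open U \<Longrightarrow> Ck_on k U (\<lambda>x. x \<bullet> b)"
proof (cases k)
  case (Suc j)
  assume "open U"
  then show ?thesis unfolding Suc
    by (intro Ck_on_SucI[where f' = "\<lambda>_ v. v \<bullet> b"] Ck_on_const)
      (auto intro!: derivative_eq_intros)
qed (auto intro!: continuous_intros)

lemma Ck_on_add: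
  assumes "open U"
  shows "Ck_on k U f \<Longrightarrow> Ck_on k U g \<Longrightarrow> Ck_on k U (\<lambda>x. f x + g x)"
proof (induction k arbitrary: f g)
  case (Suc k)
  show ?case
  proof (rule Ck_on_SucI[OF assms])
    show "((\<lambda>x. f x + g x) has_derivative
        (\<lambda>v. frechet_derivative f (at x) v + frechet_derivative g (at x) v)) (at x)" if "x \<in> U" for x
      using Suc.prems that by (intro has_derivative_add Ck_on_has_derivative)
  qed (use Suc in \<open>auto intro!: Suc.IH\<close>)
qed (auto intro!: continuous_intros)

lemma Ck_on_mult:
  assumes "open U"
  shows "Ck_on k U f \<Longrightarrow> Ck_on k U g \<Longrightarrow> Ck_on k U (\<lambda>x. f x * g x)"
proof (induction k arbitrary: f g)
  case (Suc k)
  show ?case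
  proof (rule Ck_on_SucI[OF assms])
    show "((\<lambda>x. f x * g x) has_derivative
        (\<lambda>v. f x * frechet_derivative g (at x) v + frechet_derivative f (at x) v * g x)) (at x)"
      if "x \<in> U" for x
      using Suc.prems that by (intro has_derivative_mult Ck_on_has_derivative)
    show "Ck_on k U (\<lambda>x. f x * frechet_derivative g (at x) v + frechet_derivative f (at x) v * g x)" for v
      using Suc.prems
      by (intro Ck_on_add[OF assms] Suc.IH Ck_on_frechet_derivative; simp only: Ck_on_SucD)
  qed
qed (auto intro!: continuous_intros)

lemma Ck_on_sum:
  assumes "open U" "\<And>i. i \<in> I \<Longrightarrow> Ck_on k U (f i)"
  shows "Ck_on k U (\<lambda>x. \<Sum>i\<in>I. f i x)"
  using assms(2)
  by (induction I rule: infinite_finite_induct) (auto intro!: Ck_on_const Ck_on_add assms(1))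

text \<open>The second difference of f along h u and h v is symmetric in u and v. Two applications
  of the mean value theorem, in either order, express it as h^2 times a mixed derivative at a point
  near x; continuity of both mixed derivatives at x finishes the proof.\<close>

lemma frechet_derivative_commute:
  fixes f :: "'a::real_normed_vector \<Rightarrow> real"
  assumes f: "Ck_on 2 U f" and "open U" "x \<in> U"
  shows "frechet_derivative (\<lambda>y. frechet_derivative f (at y) u) (at x) v
       = frechet_derivative (\<lambda>y. frechet_derivative f (at y) v) (at x) u"
proof -
  define D where "D w y = frechet_derivative f (at y) w" for w y
  define E where "E w w' y = frechet_derivative (D w) (at y) w'" for w w' y
  have f': "Ck_on (Suc (Suc 0)) U f" using f by (simp add: numeral_2_eq_2)
  have dD: "(f has_derivative (\<lambda>w. D w y)) (at y)" if "y \<in> U" for y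
    using Ck_on_has_derivative[OF f' that] by (simp add: D_def)
  have CD: "Ck_on (Suc 0) U (D w)" for w
    unfolding D_def using f' by (rule Ck_on_frechet_derivative)
  have dE: "(D w has_derivative (\<lambda>w'. E w w' y)) (at y)" if "y \<in> U" for y w
    using Ck_on_has_derivative[OF CD that] by (simp add: E_def)
  have cE: "continuous_on U (E w w')" for w w'
    using CD[of w] unfolding E_def by auto
  have key: "\<exists>s t. 0 < s \<and> s < h \<and> 0 < t \<and> t < h \<and>
      f (x + h *\<^sub>R u + h *\<^sub>R v) - f (x + h *\<^sub>R u) - f (x + h *\<^sub>R v) + f x
       = h * (h * E u v (x + s *\<^sub>R u + t *\<^sub>R v))"
    if h: "h > 0" and sub: "\<And>s t. 0 \<le> s \<Longrightarrow> s \<le> h \<Longrightarrow> 0 \<le> t \<Longrightarrow> t \<le> h \<Longrightarrow> x + s *\<^sub>R u + t *\<^sub>R v \<in> U"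
    for h u v
  proof -
    have 1: "((\<lambda>s. f (x + s *\<^sub>R u + t *\<^sub>R v)) has_real_derivative D u (x + s *\<^sub>R u + t *\<^sub>R v)) (at s)"
      if "0 \<le> s" "s \<le> h" "0 \<le> t" "t \<le> h" for s t
    proof -
      have lin: "linear (\<lambda>w. D w (x + s *\<^sub>R u + t *\<^sub>R v))"
        using dD[OF sub[OF that]] by (rule has_derivative_linear)
      have "((\<lambda>s. f (x + s *\<^sub>R u + t *\<^sub>R v)) has_derivative (\<lambda>d. D (d *\<^sub>R u) (x + s *\<^sub>R u + t *\<^sub>R v))) (at s)"
        by (rule has_derivative_compose[where f = "\<lambda>s. x + s *\<^sub>R u + t *\<^sub>R v" and f' = "\<lambda>d. d *\<^sub>R u",
              OF _ dD[OF sub[OF that]]]) (auto intro!: derivative_eq_intros)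
      then show ?thesis
        unfolding has_field_derivative_def using linear_scale[OF lin] by (simp add: mult_commute_abs)
    qed
    have 2: "((\<lambda>t. D u (x + s *\<^sub>R u + t *\<^sub>R v)) has_real_derivative E u v (x + s *\<^sub>R u + t *\<^sub>R v)) (at t)"
      if "0 \<le> s" "s \<le> h" "0 \<le> t" "t \<le> h" for s t
    proof -
      have lin: "linear (\<lambda>w. E u w (x + s *\<^sub>R u + t *\<^sub>R v))"
        using dE[OF sub[OF that]] by (rule has_derivative_linear)
      have "((\<lambda>t. D u (x + s *\<^sub>R u + t *\<^sub>R v)) has_derivative (\<lambda>d. E u (d *\<^sub>R v) (x + s *\<^sub>R u + t *\<^sub>R v))) (at t)"
        by (rule has_derivative_compose[where f = "\<lambda>t. x + s *\<^sub>R u + t *\<^sub>R v" and f' = "\<lambda>d. d *\<^sub>R v",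
              OF _ dE[OF sub[OF that]]]) (auto intro!: derivative_eq_intros)
      then show ?thesis
        unfolding has_field_derivative_def using linear_scale[OF lin] by (simp add: mult_commute_abs)
    qed
    \<comment> \<open>The terms \<open>0 *\<^sub>R u\<close> and \<open>0 *\<^sub>R v\<close> stay
      unsimplified so that both sides are visibly values of one function of s, at h and at
      0.\<close>
    have "\<exists>s. 0 < s \<and> s < h \<and> (f (x + h *\<^sub>R u + h *\<^sub>R v) - f (x + h *\<^sub>R u + 0 *\<^sub>R v))
         - (f (x + 0 *\<^sub>R u + h *\<^sub>R v) - f (x + 0 *\<^sub>R u + 0 *\<^sub>R v))
       = (h - 0) * (D u (x + s *\<^sub>R u + h *\<^sub>R v) - D u (x + s *\<^sub>R u + 0 *\<^sub>R v))"
      using h by (intro MVT2 DERIV_diff 1) auto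
    then obtain s where s: "0 < s" "s < h" "(f (x + h *\<^sub>R u + h *\<^sub>R v) - f (x + h *\<^sub>R u + 0 *\<^sub>R v))
         - (f (x + 0 *\<^sub>R u + h *\<^sub>R v) - f (x + 0 *\<^sub>R u + 0 *\<^sub>R v))
       = (h - 0) * (D u (x + s *\<^sub>R u + h *\<^sub>R v) - D u (x + s *\<^sub>R u + 0 *\<^sub>R v))" by blast
    have "\<exists>t. 0 < t \<and> t < h \<and> D u (x + s *\<^sub>R u + h *\<^sub>R v) - D u (x + s *\<^sub>R u + 0 *\<^sub>R v)
        = (h - 0) * E u v (x + s *\<^sub>R u + t *\<^sub>R v)"
      using h s by (intro MVT2 2) auto
    then obtain t where "0 < t" "t < h" "D u (x + s *\<^sub>R u + h *\<^sub>R v) - D u (x + s *\<^sub>R u + 0 *\<^sub>R v)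
        = (h - 0) * E u v (x + s *\<^sub>R u + t *\<^sub>R v)" by blast
    with s show ?thesis by (intro exI[of _ s] exI[of _ t]) (simp add: algebra_simps)
  qed
  have "\<bar>E u v x - E v u x\<bar> \<le> e" if "e > 0" for e
  proof -
    have "\<exists>d>0. \<forall>y. dist y x < d \<longrightarrow> y \<in> U \<and> \<bar>E u v y - E u v x\<bar> < e/2 \<and> \<bar>E v u y - E v u x\<bar> < e/2"
    proof -
      have "(E u v \<longlongrightarrow> E u v x) (nhds x)" "(E v u \<longlongrightarrow> E v u x) (nhds x)"
        using cE assms(2,3) continuous_on_eq_continuous_at
        unfolding tendsto_at_iff_tendsto_nhds[symmetric] isCont_def[symmetric] by blast+
      from tendstoD[OF this(1), of "e/2"] tendstoD[OF this(2), of "e/2"]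
      have "\<forall>\<^sub>F y in nhds x. \<bar>E u v y - E u v x\<bar> < e/2" "\<forall>\<^sub>F y in nhds x. \<bar>E v u y - E v u x\<bar> < e/2"
        using that by (simp_all add: dist_real_def)
      moreover have "\<forall>\<^sub>F y in nhds x. y \<in> U"
        using assms(2,3) eventually_nhds_in_open by blast
      ultimately have "\<forall>\<^sub>F y in nhds x. y \<in> U \<and> \<bar>E u v y - E u v x\<bar> < e/2 \<and> \<bar>E v u y - E v u x\<bar> < e/2"
        by eventually_elim auto
      then show ?thesis unfolding eventually_nhds_metric by blast
    qed
    then obtain d where d: "d > 0" "\<And>y. dist y x < d \<Longrightarrow> y \<in> U \<and> \<bar>E u v y - E u v x\<bar> < e/2 \<and> \<bar>E v u y - E v u x\<bar> < e/2"
      by blast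
    \<comment> \<open>The summand 1 keeps \<open>N\<close> positive when u = v = 0; then h N = d / 2
      keeps the parallelogram with sides h u and h v inside the ball of radius d.\<close>
    define N where "N = norm u + norm v + 1"
    define h where "h = d / (2 * N)"
    have n: "N > 0" unfolding N_def by (smt (verit) norm_ge_zero)
    have h: "h > 0" using d(1) n by (simp add: h_def)
    have near: "dist (x + s *\<^sub>R u + t *\<^sub>R v) x < d" if "0 \<le> s" "s \<le> h" "0 \<le> t" "t \<le> h" for s t
    proof -
      have "dist (x + s *\<^sub>R u + t *\<^sub>R v) x = norm (s *\<^sub>R u + t *\<^sub>R v)"
        by (simp add: dist_norm add.assoc)
      also have "\<dots> \<le> norm (s *\<^sub>R u) + norm (t *\<^sub>R v)"
        by (rule norm_triangle_ineq)
      also have "\<dots> \<le> h * norm u + h * norm v"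
        using that by (auto intro!: add_mono mult_right_mono)
      also have "\<dots> \<le> h * N" using h by (simp add: N_def algebra_simps)
      also have "\<dots> < d" using n d(1) by (simp add: h_def)
      finally show ?thesis .
    qed
    have near': "dist (x + s *\<^sub>R v + t *\<^sub>R u) x < d" if "0 \<le> s" "s \<le> h" "0 \<le> t" "t \<le> h" for s t
      using near[OF that(3,4,1,2)] by (simp add: add_ac)
    obtain s t where st: "0 < s" "s < h" "0 < t" "t < h"
      "f (x + h *\<^sub>R u + h *\<^sub>R v) - f (x + h *\<^sub>R u) - f (x + h *\<^sub>R v) + f x
       = h * (h * E u v (x + s *\<^sub>R u + t *\<^sub>R v))"
      using key[OF h, of u v] d(2)[OF near] by metis
    obtain s' t' where st': "0 < s'" "s' < h" "0 < t'" "t' < h"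
      "f (x + h *\<^sub>R v + h *\<^sub>R u) - f (x + h *\<^sub>R v) - f (x + h *\<^sub>R u) + f x
       = h * (h * E v u (x + s' *\<^sub>R v + t' *\<^sub>R u))"
      using key[OF h, of v u] d(2)[OF near'] by metis
    have "h * (h * E u v (x + s *\<^sub>R u + t *\<^sub>R v)) = h * (h * E v u (x + s' *\<^sub>R v + t' *\<^sub>R u))"
      unfolding st(5)[symmetric] st'(5)[symmetric] by (simp add: add_ac)
    then have eq: "E u v (x + s *\<^sub>R u + t *\<^sub>R v) = E v u (x + s' *\<^sub>R v + t' *\<^sub>R u)"
      using h by simp
    have "\<bar>E u v (x + s *\<^sub>R u + t *\<^sub>R v) - E u v x\<bar> < e/2"
      using d(2) near[of s t] st by auto
    moreover have "\<bar>E v u (x + s' *\<^sub>R v + t' *\<^sub>R u) - E v u x\<bar> < e/2"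
      using d(2) near'[of s' t'] st' by auto
    ultimately show ?thesis using eq by linarith
  qed
  then have "\<bar>E u v x - E v u x\<bar> \<le> 0" by (rule field_le_epsilon) simp
  then show ?thesis unfolding E_def D_def by simp
qed

subsection \<open>Alternating forms and the exterior derivative\<close>

text \<open>A common form for three constructions: \<Phi> the directional derivative of a form gives
  the exterior derivative, \<Phi> v ws = \<alpha> (v # ws) gives a multiple of the covector
  \<alpha>, and \<Phi> v ws = (u \<bullet> v) \<beta> ws gives the wedge of u (as a 1-form) with
  \<beta>.\<close>

definition alternation :: "('a \<Rightarrow> 'a list \<Rightarrow> real) \<Rightarrow> 'a list \<Rightarrow> real" where
  "alternation \<Phi> vs = (\<Sum>i<length vs. (-1) ^ i * \<Phi> (vs ! i) (take i vs @ drop (Suc i) vs))"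

lemma alternation_Cons:
  "alternation \<Phi> (v # vs) = \<Phi> v vs - alternation (\<lambda>w ws. \<Phi> w (v # ws)) vs"
  unfolding alternation_def
  by (simp add: sum.lessThan_Suc_shift sum_negf[symmetric] del: sum.lessThan_Suc)

lemma alternation_zero: "(\<And>w ws. \<Phi> w ws = 0) \<Longrightarrow> alternation \<Phi> vs = 0"
  by (simp add: alternation_def)

lemma ext_deriv_eq_alternation:
  "ext_deriv \<omega> x = alternation (\<lambda>v ws. frechet_derivative (\<lambda>y. \<omega> y ws) (at x) v)"
  by (simp add: fun_eq_iff ext_deriv_def alternation_def)

lemma covector_linear:
  "covector r \<alpha> \<Longrightarrow> length vs = r \<Longrightarrow> i < r \<Longrightarrow> linear (\<lambda>v. \<alpha> (vs[i := v]))"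
  by (simp add: covector_def)

lemma covector_not_distinct: "covector r \<alpha> \<Longrightarrow> \<not> distinct vs \<Longrightarrow> \<alpha> vs = 0"
  by (cases "length vs = r") (auto simp: covector_def)

lemma covector_length: "covector r \<alpha> \<Longrightarrow> length vs \<noteq> r \<Longrightarrow> \<alpha> vs = 0"
  by (auto simp: covector_def)

lemma covector_linear_hd:
  assumes "covector (Suc r) \<alpha>"
  shows "linear (\<lambda>v. \<alpha> (v # ws))"
proof (cases "length ws = r")
  case True
  then show ?thesis using covector_linear[OF assms, of "0 # ws" 0] by simp
next
  case False
  then have "(\<lambda>v. \<alpha> (v # ws)) = (\<lambda>v. 0)" using covector_length[OF assms] by auto
  then show ?thesis by (simp add: linear_iff)
qed

lemma covector_Cons:
  assumes "covector (Suc r) \<alpha>"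
  shows "covector r (\<lambda>ws. \<alpha> (v # ws))"
  unfolding covector_def
proof (intro conjI allI impI)
  fix vs :: "'a list" and i
  assume "length vs = r \<and> i < r"
  then show "linear (\<lambda>w. \<alpha> (v # vs[i := w]))"
    using covector_linear[OF assms, of "v # vs" "Suc i"] by simp
qed (use covector_not_distinct[OF assms] covector_length[OF assms] in auto)

text \<open>Polarisation: expand 0 = \<alpha> ((v + w) # (v + w) # ws). Lists of the wrong length
  are covered by the normalisation to 0.\<close>

lemma covector_swap:
  assumes "covector r \<alpha>"
  shows "\<alpha> (v # w # ws) = - \<alpha> (w # v # ws)"
proof (cases "r = Suc (Suc (length ws))")
  case True
  have l0: "linear (\<lambda>v. \<alpha> (v # u # ws))" for u
    using covector_linear_hd assms True by blast
  have l1: "linear (\<lambda>v. \<alpha> (u # v # ws))" for u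
    using covector_linear_hd[OF covector_Cons] assms True by blast
  have "0 = \<alpha> ((v + w) # (v + w) # ws)"
    using covector_not_distinct[OF assms] by simp
  also have "\<dots> = \<alpha> (v # v # ws) + \<alpha> (v # w # ws) + (\<alpha> (w # v # ws) + \<alpha> (w # w # ws))"
    by (simp add: linear_add[OF l0] linear_add[OF l1])
  also have "\<dots> = \<alpha> (v # w # ws) + \<alpha> (w # v # ws)"
    using covector_not_distinct[OF assms] by simp
  finally show ?thesis by simp
next
  case False
  then show ?thesis using covector_length[OF assms] by simp
qed

lemma covector_move:
  "covector r \<alpha> \<Longrightarrow> \<alpha> (v # ys @ zs) = (-1) ^ length ys * \<alpha> (ys @ v # zs)"
proof (induction ys arbitrary: r \<alpha>)
  case (Cons y ys)
  show ?case
  proof (cases r)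
    case 0
    then show ?thesis using covector_length[OF Cons.prems] by simp
  next
    case (Suc s)
    have "\<alpha> (v # (y # ys) @ zs) = - \<alpha> (y # v # ys @ zs)"
      using covector_swap[OF Cons.prems, of v y] by simp
    then show ?thesis
      using Cons.IH[OF covector_Cons[of s \<alpha> y]] Cons.prems Suc by simp
  qed
qed simp

text \<open>Moving the removed entry back to position i costs a second sign (-1)^i, so all summands
  agree. This is the origin of the factor r + 1 in the homotopy formula.\<close>

lemma alternation_covector:
  assumes "covector r \<alpha>"
  shows "alternation (\<lambda>v ws. \<alpha> (v # ws)) vs = real (length vs) * \<alpha> vs"
proof -
  have "(-1) ^ i * \<alpha> (vs ! i # take i vs @ drop (Suc i) vs) = \<alpha> vs" if "i < length vs" for i
  proof -
    have "\<alpha> (vs ! i # take i vs @ drop (Suc i) vs) = (-1) ^ i * \<alpha> (take i vs @ vs ! i # drop (Suc i) vs)"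
      using covector_move[OF assms, of "vs ! i" "take i vs" "drop (Suc i) vs"] that by simp
    also have "take i vs @ vs ! i # drop (Suc i) vs = vs" using that by (simp add: id_take_nth_drop[symmetric])
    finally show ?thesis by (simp add: power_add[symmetric] mult.assoc[symmetric])
  qed
  then show ?thesis by (simp add: alternation_def)
qed

lemma linear_alternation:
  assumes "\<And>ws. Suc (length ws) = length vs \<Longrightarrow> linear (\<lambda>v. \<Phi> v ws)"
    and "\<And>w ws i. Suc (length ws) = length vs \<Longrightarrow> i < length ws \<Longrightarrow> linear (\<lambda>v. \<Phi> w (ws[i := v]))"
    and "i < length vs"
  shows "linear (\<lambda>v. alternation \<Phi> (vs[i := v]))"
  using assms
proof (induction vs arbitrary: \<Phi> i)
  case (Cons u us)
  show ?case
  proof (cases i)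
    case 0
    have "linear (\<lambda>v. alternation (\<lambda>w ws. \<Phi> w (v # ws)) us)"
      unfolding alternation_def
    proof (intro linear_compose_sum ballI)
      fix j assume "j \<in> {..<length us}"
      then have "linear (\<lambda>v. \<Phi> (us ! j) ((0 # take j us @ drop (Suc j) us)[0 := v]))"
        by (intro Cons.prems(2)) auto
      then show "linear (\<lambda>v. (-1) ^ j * \<Phi> (us ! j) (v # take j us @ drop (Suc j) us))"
        by (simp add: linear_iff algebra_simps)
    qed
    with Cons.prems(1)[of us] show ?thesis
      by (simp add: 0 alternation_Cons linear_compose_sub)
  next
    case (Suc j)
    have "linear (\<lambda>v. alternation (\<lambda>w ws. \<Phi> w (u # ws)) (us[j := v]))"
    proof (rule Cons.IH)
      show "linear (\<lambda>v. \<Phi> w (u # ws[i := v]))" if "Suc (length ws) = length us" "i < length ws" for w ws i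
        using Cons.prems(2)[of "u # ws" "Suc i" w] that by simp
    qed (use Cons.prems Suc in auto)
    with Cons.prems(2)[of us j u] Cons.prems(3) show ?thesis
      by (simp add: Suc alternation_Cons linear_compose_sub)
  qed
qed simp

text \<open>Every summand that removes another position leaves this \<open>v\<close> in the list and
  vanishes; the surviving one sits at position \<open>length ys\<close>.\<close>

lemma alternation_remove:
  assumes "\<And>w ws. v \<in> set ws \<Longrightarrow> \<Phi> w ws = 0"
  shows "alternation \<Phi> (ys @ v # zs) = (-1) ^ length ys * \<Phi> v (ys @ zs)"
  using assms
proof (induction ys arbitrary: \<Phi>)
  case Nil
  have "alternation (\<lambda>w ws. \<Phi> w (v # ws)) zs = 0"
    using Nil by (simp add: alternation_def)
  then show ?case by (simp add: alternation_Cons)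
next
  case (Cons y ys)
  then show ?case by (simp add: alternation_Cons)
qed

text \<open>Only the two summands that remove one of the two copies of \<open>v\<close> survive, and
  their signs are opposite once the other copy is moved into place. The induction strips
  \<open>xs\<close> by fixing a first argument, which lowers the degree by one.\<close>

lemma alternation_not_distinct:
  assumes "\<And>v. covector r (\<Phi> v)"
  shows "alternation \<Phi> (xs @ v # ys @ v # zs) = 0"
  using assms
proof (induction xs arbitrary: r \<Phi>)
  case Nil
  have "alternation (\<lambda>w ws. \<Phi> w (v # ws)) (ys @ v # zs) = (-1) ^ length ys * \<Phi> v (v # ys @ zs)"
    using covector_not_distinct[OF Nil] by (intro alternation_remove) auto
  also have "\<dots> = \<Phi> v (ys @ v # zs)"
    using covector_move[OF Nil] by (simp add: power_add[symmetric] mult.assoc[symmetric])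
  finally show ?case by (simp add: alternation_Cons)
next
  case (Cons x xs)
  have *: "\<Phi> x (xs @ v # ys @ v # zs) = 0"
    using covector_not_distinct[OF Cons.prems] by simp
  show ?case
  proof (cases r)
    case 0
    then have "\<Phi> w (x # ws) = 0" for w ws using covector_length[OF Cons.prems] by simp
    then show ?thesis using * by (simp add: alternation_Cons alternation_zero)
  next
    case (Suc s)
    then have "alternation (\<lambda>w ws. \<Phi> w (x # ws)) (xs @ v # ys @ v # zs) = 0"
      using Cons.prems by (intro Cons.IH[of s] covector_Cons) simp
    then show ?thesis using * by (simp add: alternation_Cons)
  qed
qed

lemma covector_alternation:
  assumes "\<And>v. covector r (\<Phi> v)" and "\<And>ws. linear (\<lambda>v. \<Phi> v ws)"
  shows "covector (Suc r) (alternation \<Phi>)"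
  unfolding covector_def
proof (intro conjI allI impI)
  fix vs :: "'a list" and i
  assume "length vs = Suc r \<and> i < Suc r"
  then show "linear (\<lambda>v. alternation \<Phi> (vs[i := v]))"
    by (intro linear_alternation assms(2)) (auto intro: covector_linear[OF assms(1)])
next
  fix vs :: "'a list"
  assume "length vs = Suc r \<and> \<not> distinct vs"
  then show "alternation \<Phi> vs = 0"
    using not_distinct_decomp alternation_not_distinct[of r \<Phi>, OF assms(1)] by fastforce
next
  fix vs :: "'a list"
  assume "length vs \<noteq> Suc r"
  then show "alternation \<Phi> vs = 0"
    using covector_length[OF assms(1)] by (auto simp: alternation_def intro!: sum.neutral)
qed

lemma covector_scale: "covector r \<alpha> \<Longrightarrow> covector r (\<lambda>vs. c * \<alpha> vs)"
  by (auto simp: covector_def linear_iff algebra_simps)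

section \<open>The Euclidean norm of a contraction\<close>

abbreviation basis_tuples :: "nat \<Rightarrow> 'a::euclidean_space list set" where
  "basis_tuples r \<equiv> {es. length es = r \<and> set es \<subseteq> Basis}"

lemma sum_basis_tuples_Suc:
  fixes g :: "'a::euclidean_space \<Rightarrow> 'a list \<Rightarrow> real"
  assumes "i \<le> r"
  shows "(\<Sum>es\<in>basis_tuples (Suc r). g (es ! i) (take i es @ drop (Suc i) es))
       = (\<Sum>es\<in>basis_tuples r. \<Sum>b\<in>Basis. g b es)"
proof -
  have "(\<Sum>es\<in>basis_tuples (Suc r). g (es ! i) (take i es @ drop (Suc i) es))
      = (\<Sum>(es, b)\<in>basis_tuples r \<times> Basis. g b es)"
  proof (rule sum.reindex_bij_witness[where
        i = "\<lambda>(es, b). take i es @ b # drop i es" and j = "\<lambda>es. (take i es @ drop (Suc i) es, es ! i)"])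
    fix es :: "'a list" assume es: "es \<in> basis_tuples (Suc r)"
    then show "(case (take i es @ drop (Suc i) es, es ! i) of (es, b) \<Rightarrow> take i es @ b # drop i es) = es"
      using assms by (simp add: min_def id_take_nth_drop[symmetric])
    show "(take i es @ drop (Suc i) es, es ! i) \<in> basis_tuples r \<times> Basis"
      using es assms by (auto dest: in_set_takeD in_set_dropD)
  qed (use assms in \<open>auto simp: nth_append min_def dest: in_set_takeD in_set_dropD\<close>)
  then show ?thesis by (simp add: sum.cartesian_product)
qed

text \<open>Wedging with u is adjoint to contraction by u. Each of the r + 1 positions of the entry
  paired with u contributes the same sum, which accounts for the factor; it is the quotient of the
  factorials in the two norms.\<close>

lemma sum_covector_alternation:
  fixes \<alpha> :: "'a::euclidean_space list \<Rightarrow> real"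
  assumes "covector (Suc r) \<alpha>"
  shows "(\<Sum>es\<in>basis_tuples (Suc r). \<alpha> es * alternation (\<lambda>v ws. (u \<bullet> v) * \<beta> ws) es)
       = real (Suc r) * (\<Sum>es\<in>basis_tuples r. \<alpha> (u # es) * \<beta> es)"
proof -
  have contract: "(\<Sum>b\<in>Basis. \<alpha> (b # es) * ((u \<bullet> b) * \<beta> es)) = \<alpha> (u # es) * \<beta> es" for es
  proof -
    have "\<alpha> (u # es) = \<alpha> ((\<Sum>b\<in>Basis. (u \<bullet> b) *\<^sub>R b) # es)"
      by (simp add: euclidean_representation)
    also have "\<dots> = (\<Sum>b\<in>Basis. (u \<bullet> b) * \<alpha> (b # es))"
      using linear_sum[OF covector_linear_hd[OF assms, of es], of "\<lambda>b. (u \<bullet> b) *\<^sub>R b" Basis]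
        linear_scale[OF covector_linear_hd[OF assms, of es]] by simp
    finally show ?thesis by (simp add: sum_distrib_left sum_distrib_right mult_ac)
  qed
  have "(\<Sum>es\<in>basis_tuples (Suc r). \<alpha> es * alternation (\<lambda>v ws. (u \<bullet> v) * \<beta> ws) es)
      = (\<Sum>es\<in>basis_tuples (Suc r). \<Sum>i<Suc r.
          \<alpha> (es ! i # take i es @ drop (Suc i) es) * ((u \<bullet> (es ! i)) * \<beta> (take i es @ drop (Suc i) es)))"
  proof (intro sum.cong refl)
    fix es :: "'a list" assume es: "es \<in> basis_tuples (Suc r)"
    have "\<alpha> es * (-1) ^ i = \<alpha> (es ! i # take i es @ drop (Suc i) es)" if "i < Suc r" for i
    proof -
      have "\<alpha> (es ! i # take i es @ drop (Suc i) es) = (-1) ^ i * \<alpha> (take i es @ es ! i # drop (Suc i) es)"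
        using covector_move[OF assms, of "es ! i" "take i es" "drop (Suc i) es"] that es by simp
      also have "take i es @ es ! i # drop (Suc i) es = es"
        using that es by (simp add: id_take_nth_drop[symmetric])
      finally show ?thesis by simp
    qed
    then show "\<alpha> es * alternation (\<lambda>v ws. (u \<bullet> v) * \<beta> ws) es = (\<Sum>i<Suc r.
          \<alpha> (es ! i # take i es @ drop (Suc i) es) * ((u \<bullet> (es ! i)) * \<beta> (take i es @ drop (Suc i) es)))"
      using es by (auto simp add: alternation_def sum_distrib_left simp del: sum.lessThan_Suc intro!: sum.cong)
  qed
  also have "\<dots> = (\<Sum>i<Suc r. \<Sum>es\<in>basis_tuples (Suc r).
          \<alpha> (es ! i # take i es @ drop (Suc i) es) * ((u \<bullet> (es ! i)) * \<beta> (take i es @ drop (Suc i) es)))"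
    by (rule sum.swap)
  also have "\<dots> = (\<Sum>i<Suc r. \<Sum>es\<in>basis_tuples r. \<alpha> (u # es) * \<beta> es)"
    using sum_basis_tuples_Suc[where g = "\<lambda>b es. \<alpha> (b # es) * ((u \<bullet> b) * \<beta> es)" and r = r]
    by (rule_tac sum.cong[OF refl]) (simp add: contract)
  finally show ?thesis by (simp del: sum.lessThan_Suc)
qed

text \<open>Cauchy--Schwarz applied to \<open>\<alpha>\<close> and \<open>u \<and> (\<iota>\<^sub>u \<alpha>)\<close>, whose squared norm is
  \<open>|u|\<^sup>2 |\<iota>\<^sub>u \<alpha>|\<^sup>2\<close> because \<open>\<iota>\<^sub>u \<iota>\<^sub>u \<alpha> = 0\<close>.\<close>

lemma covector_norm_contract:
  fixes \<alpha> :: "'a::euclidean_space list \<Rightarrow> real"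
  assumes "covector (Suc r) \<alpha>"
  shows "covector_norm r (\<lambda>es. \<alpha> (u # es)) \<le> norm u * covector_norm (Suc r) \<alpha>"
proof -
  define \<beta> where "\<beta> = (\<lambda>es. \<alpha> (u # es))"
  define \<gamma> where "\<gamma> = alternation (\<lambda>v ws. (u \<bullet> v) * \<beta> ws)"
  define A where "A = (\<Sum>es\<in>basis_tuples (Suc r). (\<alpha> es)\<^sup>2)"
  define B where "B = (\<Sum>es\<in>basis_tuples r. (\<beta> es)\<^sup>2)"
  have \<beta>: "covector r \<beta>" unfolding \<beta>_def by (rule covector_Cons[OF assms])
  have \<gamma>: "covector (Suc r) \<gamma>" unfolding \<gamma>_def
    by (intro covector_alternation covector_scale \<beta>) (simp add: linear_iff inner_add_right algebra_simps)
  have \<gamma>u: "\<gamma> (u # es) = (norm u)\<^sup>2 * \<beta> es" for es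
  proof -
    have "\<beta> (u # ws) = 0" for ws
      unfolding \<beta>_def using covector_not_distinct[OF assms] by simp
    then show ?thesis unfolding \<gamma>_def
      by (simp add: alternation_Cons dot_square_norm alternation_zero)
  qed
  have 1: "(\<Sum>es\<in>basis_tuples (Suc r). \<alpha> es * \<gamma> es) = real (Suc r) * B"
    unfolding \<gamma>_def using sum_covector_alternation[OF assms, of u \<beta>]
    by (simp add: B_def \<beta>_def power2_eq_square)
  have 2: "(\<Sum>es\<in>basis_tuples (Suc r). (\<gamma> es)\<^sup>2) = real (Suc r) * ((norm u)\<^sup>2 * B)"
    using sum_covector_alternation[OF \<gamma>, of u \<beta>] unfolding \<gamma>_def[symmetric] \<gamma>u
    by (simp add: B_def sum_distrib_left power2_eq_square mult_ac)
  have "(real (Suc r) * B)\<^sup>2 \<le> A * (real (Suc r) * ((norm u)\<^sup>2 * B))"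
    unfolding 1[symmetric] 2[symmetric] A_def by (rule Cauchy_Schwarz_ineq_sum)
  then have "(real (Suc r) * B) * (real (Suc r) * B) \<le> (real (Suc r) * B) * ((norm u)\<^sup>2 * A)"
    by (simp only: power2_eq_square mult_ac)
  moreover have "B \<ge> 0" "A \<ge> 0" unfolding A_def B_def by (auto intro: sum_nonneg)
  ultimately have "real (Suc r) * B \<le> (norm u)\<^sup>2 * A"
    by (cases "B = 0") (auto dest: mult_left_le_imp_le)
  then have "real (Suc r) * B / fact (Suc r) \<le> (norm u)\<^sup>2 * A / fact (Suc r)"
    by (rule divide_right_mono) simp
  then have "B / fact r \<le> (norm u)\<^sup>2 * A / fact (Suc r)"
    by (simp add: fact_Suc del: of_nat_Suc)
  then have "sqrt (B / fact r) \<le> sqrt ((norm u)\<^sup>2 * (A / fact (Suc r)))"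
    by simp
  then have "sqrt (B / fact r) \<le> norm u * sqrt (A / fact (Suc r))"
    by (simp only: real_sqrt_mult real_sqrt_abs abs_norm_cancel)
  then show ?thesis
    unfolding covector_norm_def A_def B_def \<beta>_def .
qed

text \<open>Cartan's formula for the constant vector field v: contracting d\<omega> with v gives the
  derivative of \<omega> along v minus d of the contraction of \<omega> with v.\<close>

lemma ext_deriv_Cons:
  "ext_deriv \<omega> x (v # vs) = frechet_derivative (\<lambda>y. \<omega> y vs) (at x) v - ext_deriv (\<lambda>y ws. \<omega> y (v # ws)) x vs"
  by (simp add: ext_deriv_eq_alternation alternation_Cons)

lemma Ck_on_ext_deriv:
  assumes "open U" "\<And>ws. Ck_on (Suc k) U (\<lambda>x. \<omega> x ws)"
  shows "Ck_on k U (\<lambda>x. ext_deriv \<omega> x vs)"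
  unfolding ext_deriv_def
  by (intro Ck_on_sum Ck_on_mult Ck_on_const assms(1) Ck_on_frechet_derivative assms(2))

lemma ext_deriv_diff:
  assumes "\<And>ws. (\<lambda>y. \<alpha> y ws) differentiable (at x)" "\<And>ws. (\<lambda>y. \<beta> y ws) differentiable (at x)"
  shows "ext_deriv (\<lambda>y ws. \<alpha> y ws - \<beta> y ws) x vs = ext_deriv \<alpha> x vs - ext_deriv \<beta> x vs"
proof -
  have "frechet_derivative (\<lambda>y. \<alpha> y ws - \<beta> y ws) (at x)
      = (\<lambda>v. frechet_derivative (\<lambda>y. \<alpha> y ws) (at x) v - frechet_derivative (\<lambda>y. \<beta> y ws) (at x) v)" for ws
    using assms by (intro frechet_derivative_eqI has_derivative_diff) (auto simp: frechet_derivative_works)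
  then show ?thesis by (simp add: ext_deriv_def sum_subtractf algebra_simps)
qed

text \<open>By Cartan's formula, used for d\<omega> and for \<omega>, contracting d d \<omega> with
  v leaves three terms: the derivative of d\<omega> along v, minus d of the derivative of \<omega>
  along v, plus d d of the contraction of \<omega>. The first two cancel by symmetry of second
  derivatives; the third is the induction hypothesis, hence the generalisation over
  \<omega>.\<close>

lemma ext_deriv_ext_deriv:
  fixes \<omega> :: "'a::real_normed_vector form"
  assumes "open U" "x \<in> U" "\<And>ws. Ck_on 2 U (\<lambda>x. \<omega> x ws)"
  shows "ext_deriv (ext_deriv \<omega>) x vs = 0"
  using assms(3)
proof (induction vs arbitrary: \<omega>)
  case Nil
  then show ?case by (simp add: ext_deriv_def)
next
  case (Cons v vs)
  define \<delta> where "\<delta> y ws = frechet_derivative (\<lambda>z. \<omega> z ws) (at y) v" for y ws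
  have C2: "Ck_on (Suc (Suc 0)) U (\<lambda>x. \<omega> x ws)" for ws
    using Cons.prems[of ws] by (simp add: numeral_2_eq_2)
  have C1: "Ck_on (Suc 0) U (\<lambda>y. frechet_derivative (\<lambda>z. \<omega> z ws) (at y) w)" for ws w
    using C2 by (rule Ck_on_frechet_derivative)
  have "ext_deriv (\<lambda>y ws. ext_deriv \<omega> y (v # ws)) x vs
      = ext_deriv (\<lambda>y ws. \<delta> y ws - ext_deriv (\<lambda>y ws. \<omega> y (v # ws)) y ws) x vs"
    by (simp add: ext_deriv_Cons \<delta>_def)
  also have "\<dots> = ext_deriv \<delta> x vs - ext_deriv (ext_deriv (\<lambda>y ws. \<omega> y (v # ws))) x vs"
  proof (rule ext_deriv_diff)
    show "(\<lambda>y. \<delta> y ws) differentiable at x" for ws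
      using C1 assms(2) unfolding \<delta>_def by auto
    have "Ck_on (Suc 0) U (\<lambda>y. ext_deriv (\<lambda>y ws. \<omega> y (v # ws)) y ws)" for ws
      by (intro Ck_on_ext_deriv assms(1) C2)
    then show "(\<lambda>y. ext_deriv (\<lambda>y ws. \<omega> y (v # ws)) y ws) differentiable at x" for ws
      using assms(2) by auto
  qed
  also have "ext_deriv (ext_deriv (\<lambda>y ws. \<omega> y (v # ws))) x vs = 0"
    by (intro Cons.IH Cons.prems)
  finally have 1: "ext_deriv (\<lambda>y ws. ext_deriv \<omega> y (v # ws)) x vs = ext_deriv \<delta> x vs" by simp
  have "((\<lambda>y. ext_deriv \<omega> y vs) has_derivative (\<lambda>u. \<Sum>i<length vs. (-1) ^ i *
        frechet_derivative (\<lambda>y. frechet_derivative (\<lambda>y. \<omega> y (take i vs @ drop (Suc i) vs)) (at y) (vs ! i)) (at x) u)) (at x)"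
    unfolding ext_deriv_def
    by (intro has_derivative_sum has_derivative_mult_right Ck_on_has_derivative[OF C1 assms(2)])
  then have "frechet_derivative (\<lambda>y. ext_deriv \<omega> y vs) (at x) v = (\<Sum>i<length vs. (-1) ^ i *
        frechet_derivative (\<lambda>y. frechet_derivative (\<lambda>y. \<omega> y (take i vs @ drop (Suc i) vs)) (at y) (vs ! i)) (at x) v)"
    by (drule_tac frechet_derivative_eqI) (simp only:)
  also have "\<dots> = ext_deriv \<delta> x vs"
    unfolding ext_deriv_def \<delta>_def
    by (intro sum.cong refl arg_cong2[where f = "(*)"] frechet_derivative_commute[OF Cons.prems assms(1,2)])
  finally show ?case using 1 by (simp add: ext_deriv_Cons[of "ext_deriv \<omega>"])
qed

text \<open>The identities that define a covector hold at every point of the open set, so both sides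
  can be differentiated; uniqueness of the derivative transfers them.\<close>

lemma covector_frechet_derivative:
  fixes \<omega> :: "'a::real_normed_vector form"
  assumes "open U" "x \<in> U" "\<And>y. y \<in> U \<Longrightarrow> covector r (\<omega> y)"
    and "\<And>ws. (\<lambda>y. \<omega> y ws) differentiable (at x)"
  shows "covector r (\<lambda>ws. frechet_derivative (\<lambda>y. \<omega> y ws) (at x) v)"
proof -
  define \<Phi> where "\<Phi> v ws = frechet_derivative (\<lambda>y. \<omega> y ws) (at x) v" for v ws
  have d: "((\<lambda>y. \<omega> y ws) has_derivative (\<lambda>v. \<Phi> v ws)) (at x)" for ws
    using assms(4) by (simp add: \<Phi>_def frechet_derivative_works)
  have eqI: "\<Phi> v ws = g v" if "(f has_derivative g) (at x)" "\<And>y. y \<in> U \<Longrightarrow> f y = \<omega> y ws" for v ws f g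
    using has_derivative_unique[OF d has_derivative_transform_within_open[OF that(1) assms(1,2) that(2)]]
    by (simp add: fun_eq_iff)
  have "covector r (\<Phi> v)"
    unfolding covector_def
  proof (intro conjI allI impI)
    fix vs :: "'a list" and i
    assume "length vs = r \<and> i < r"
    then have lin: "linear (\<lambda>v. \<omega> y (vs[i := v]))" if "y \<in> U" for y
      using covector_linear assms(3) that by blast
    show "linear (\<lambda>w. \<Phi> v (vs[i := w]))"
    proof (rule linearI)
      show "\<Phi> v (vs[i := a + b]) = \<Phi> v (vs[i := a]) + \<Phi> v (vs[i := b])" for a b
        by (rule eqI[OF has_derivative_add[OF d d]]) (simp add: linear_add[OF lin])
      show "\<Phi> v (vs[i := c *\<^sub>R a]) = c *\<^sub>R \<Phi> v (vs[i := a])" for a c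
        by (rule eqI[OF has_derivative_scaleR_right[OF d]]) (simp add: linear_scale[OF lin])
    qed
  next
    fix vs :: "'a list" assume "length vs = r \<and> \<not> distinct vs"
    then show "\<Phi> v vs = 0"
      using covector_not_distinct[OF assms(3)] by (intro eqI[OF has_derivative_const[of 0]]) auto
  next
    fix vs :: "'a list" assume "length vs \<noteq> r"
    then show "\<Phi> v vs = 0"
      using covector_length[OF assms(3)] by (intro eqI[OF has_derivative_const[of 0]]) auto
  qed
  then show ?thesis by (simp add: \<Phi>_def[abs_def])
qed

lemma covector_ext_deriv:
  fixes \<omega> :: "'a::real_normed_vector form"
  assumes "open U" "x \<in> U" "\<And>y. y \<in> U \<Longrightarrow> covector r (\<omega> y)"
    and "\<And>ws. (\<lambda>y. \<omega> y ws) differentiable (at x)"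
  shows "covector (Suc r) (ext_deriv \<omega> x)"
  unfolding ext_deriv_eq_alternation
  by (intro covector_alternation covector_frechet_derivative[OF assms] linear_frechet_derivative assms(4))

subsection \<open>Integrals depending on a parameter\<close>

lemma set_integrable_compact:
  fixes f :: "'a::euclidean_space \<Rightarrow> real"
  shows "compact W \<Longrightarrow> continuous_on W f \<Longrightarrow> set_integrable lborel W f"
  unfolding set_integrable_def by (rule borel_integrable_compact)

lemma abs_set_integral_le:
  fixes f :: "'a::euclidean_space \<Rightarrow> real"
  assumes "compact W" "continuous_on W f" "\<And>w. w \<in> W \<Longrightarrow> \<bar>f w\<bar> \<le> B"
  shows "\<bar>LINT w:W|lborel. f w\<bar> \<le> B * measure lborel W"
proof -
  have "\<bar>LINT w:W|lborel. f w\<bar> \<le> (LINT w:W|lborel. \<bar>f w\<bar>)"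
    using set_integral_norm_bound[OF set_integrable_compact[OF assms(1,2)]] by simp
  also have "\<dots> \<le> (LINT w:W|lborel. B)"
    using assms by (intro set_integral_mono set_integrable_compact continuous_intros) auto
  also have "\<dots> = B * measure lborel W"
    using emeasure_compact_finite[OF assms(1)] assms(1)
    by (simp add: set_lebesgue_integral_def compact_imp_closed mult.commute)
  finally show ?thesis .
qed

lemma continuous_on_param_section:
  "continuous_on (V \<times> W) (\<lambda>(x, w). G x w) \<Longrightarrow> x \<in> V \<Longrightarrow> continuous_on W (G x)"
  using continuous_on_compose2[of "V \<times> W" "\<lambda>(x, w). G x w" W "\<lambda>w. (x, w)",
      OF _ continuous_on_Pair[OF continuous_on_const continuous_on_id]]
  by auto

text \<open>Compactness of \<open>W\<close> makes the continuity in x uniform in w, so the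
  integrands differ by a constant times a finite measure.\<close>

lemma continuous_on_param_integral:
  fixes G :: "'a::metric_space \<Rightarrow> 'b::euclidean_space \<Rightarrow> real"
  assumes W: "compact W" and cont: "continuous_on (V \<times> W) (\<lambda>(x, w). G x w)"
  shows "continuous_on V (\<lambda>x. LINT w:W|lborel. G x w)"
proof (rule continuous_onI)
  fix x and e :: real assume x: "x \<in> V" and e: "e > 0"
  define e' where "e' = e / (measure lborel W + 1)"
  have m: "measure lborel W + 1 > 0" using measure_nonneg[of lborel W] by linarith
  have e': "e' > 0" using e m by (simp add: e'_def)
  obtain X where X: "x \<in> X" "open X" "\<forall>x'\<in>X \<inter> V. \<forall>w\<in>W. dist (G x' w) (G x w) \<le> e'"
    using continuous_on_prod_compactE[OF cont W x e'] by auto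
  obtain d where d: "d > 0" "ball x d \<subseteq> X" using X(1,2) open_contains_ball by blast
  have "dist (LINT w:W|lborel. G x' w) (LINT w:W|lborel. G x w) \<le> e" if "x' \<in> V" "dist x' x < d" for x'
  proof -
    have c: "continuous_on W (G x')" "continuous_on W (G x)"
      using continuous_on_param_section[OF cont] x that by auto
    have "(LINT w:W|lborel. G x' w) - (LINT w:W|lborel. G x w) = (LINT w:W|lborel. G x' w - G x w)"
      using c W by (simp add: set_integral_diff set_integrable_compact)
    also have "\<bar>\<dots>\<bar> \<le> e' * measure lborel W"
    proof (rule abs_set_integral_le[OF W])
      show "\<bar>G x' w - G x w\<bar> \<le> e'" if "w \<in> W" for w
      proof -
        have "x' \<in> X \<inter> V" using d(2) \<open>x' \<in> V\<close> \<open>dist x' x < d\<close> by (auto simp: dist_commute)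
        then show ?thesis using X(3) that by (auto simp: dist_real_def)
      qed
    qed (use c in \<open>auto intro!: continuous_intros\<close>)
    also have "\<dots> \<le> e' * (measure lborel W + 1)" using e' by simp
    also have "\<dots> = e" using m by (simp add: e'_def)
    finally show ?thesis by (simp add: dist_real_def)
  qed
  then show "\<exists>d>0. \<forall>x'\<in>V. dist x' x < d \<longrightarrow>
      dist (LINT w:W|lborel. G x' w) (LINT w:W|lborel. G x w) \<le> e"
    using d(1) by blast
qed

text \<open>For each w the mean value theorem on the segment from x to y turns the remainder into a
  difference of values of \<open>G'\<close> in the direction y - x. Expanding that direction in the
  basis leaves finitely many partial derivatives, each continuous in x uniformly over the compact
  \<open>W\<close>.\<close>

lemma has_derivative_param_integral:
  fixes G :: "'a::euclidean_space \<Rightarrow> 'b::euclidean_space \<Rightarrow> real"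
  assumes "open V" and W: "compact W" and x: "x \<in> V"
    and G: "\<And>x w. x \<in> V \<Longrightarrow> w \<in> W \<Longrightarrow> ((\<lambda>x. G x w) has_derivative G' x w) (at x)"
    and contG: "\<And>x. x \<in> V \<Longrightarrow> continuous_on W (G x)"
    and cont: "\<And>v. continuous_on (V \<times> W) (\<lambda>(x, w). G' x w v)"
  shows "((\<lambda>x. LINT w:W|lborel. G x w) has_derivative (\<lambda>v. LINT w:W|lborel. G' x w v)) (at x)"
proof -
  have lin: "linear (G' x w)" if "x \<in> V" "w \<in> W" for x w
    using G[OF that] by (rule has_derivative_linear)
  have c': "continuous_on W (\<lambda>w. G' x w v)" if "x \<in> V" for x v
    by (rule continuous_on_param_section[OF cont that])
  have int: "set_integrable lborel W (\<lambda>w. G' x w v)" for v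
    using set_integrable_compact[OF W c'[OF x]] .
  have linI: "linear (\<lambda>v. LINT w:W|lborel. G' x w v)"
  proof (rule linearI)
    fix a b c
    have "(LINT w:W|lborel. G' x w (a + b)) = (LINT w:W|lborel. G' x w a + G' x w b)"
      using W by (intro set_lebesgue_integral_cong) (auto simp: linear_add[OF lin[OF x]] compact_imp_closed)
    then show "(LINT w:W|lborel. G' x w (a + b)) = (LINT w:W|lborel. G' x w a) + (LINT w:W|lborel. G' x w b)"
      using int by (simp add: set_integral_add)
    have "(LINT w:W|lborel. G' x w (c *\<^sub>R a)) = (LINT w:W|lborel. c * G' x w a)"
      using W by (intro set_lebesgue_integral_cong) (auto simp: linear_scale[OF lin[OF x]] compact_imp_closed)
    then show "(LINT w:W|lborel. G' x w (c *\<^sub>R a)) = c *\<^sub>R (LINT w:W|lborel. G' x w a)"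
      by simp
  qed
  show ?thesis
    unfolding has_derivative_at_alt
  proof (intro conjI allI impI)
    show "bounded_linear (\<lambda>v. LINT w:W|lborel. G' x w v)"
      using linI by (simp add: linear_conv_bounded_linear)
    fix e :: real assume e: "e > 0"
    \<comment> \<open>One error \<open>e'\<close> for each basis direction, integrated over
      \<open>W\<close>; the summand 1 guards against \<open>W\<close> of measure zero.\<close>
    define m where "m = real DIM('a) * (measure lborel W + 1)"
    have m: "m > 0" unfolding m_def using measure_nonneg[of lborel W] by (intro mult_pos_pos) (auto simp: add_nonneg_pos)
    define e' where "e' = e / m"
    have e': "e' > 0" using e m by (simp add: e'_def)
    have "\<exists>X. x \<in> X \<and> open X \<and> (\<forall>x'\<in>X \<inter> V. \<forall>w\<in>W. dist (G' x' w b) (G' x w b) \<le> e')" for b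
      by (rule continuous_on_prod_compactE[OF cont[of b] W x e']) auto
    then obtain X where X: "\<And>b. x \<in> X b" "\<And>b. open (X b)"
      "\<And>b x' w. x' \<in> X b \<inter> V \<Longrightarrow> w \<in> W \<Longrightarrow> dist (G' x' w b) (G' x w b) \<le> e'"
      by metis
    have "open (V \<inter> (\<Inter>b\<in>Basis. X b))" "x \<in> V \<inter> (\<Inter>b\<in>Basis. X b)"
      using X(1,2) assms(1) x by (auto intro!: open_Int open_INT)
    then obtain d where d: "d > 0" "ball x d \<subseteq> V \<inter> (\<Inter>b\<in>Basis. X b)"
      using open_contains_ball by blast
    have "norm ((LINT w:W|lborel. G y w) - (LINT w:W|lborel. G x w) - (LINT w:W|lborel. G' x w (y - x)))
        \<le> e * norm (y - x)" if y: "norm (y - x) < d" for y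
    proof -
      define h where "h = y - x"
      have seg: "x + s *\<^sub>R h \<in> ball x d" if "0 \<le> s" "s \<le> 1" for s
      proof -
        have "norm (s *\<^sub>R h) \<le> norm h" using that by (simp add: mult_left_le_one_le)
        then show ?thesis using y by (simp add: dist_norm h_def)
      qed
      have yV: "y \<in> V" using seg[of 1] d(2) by (auto simp: h_def)
      have bound: "\<bar>G y w - G x w - G' x w h\<bar> \<le> real DIM('a) * e' * norm h" if w: "w \<in> W" for w
      proof -
        have der: "((\<lambda>s. G (x + s *\<^sub>R h) w) has_real_derivative G' (x + s *\<^sub>R h) w h) (at s)"
          if "0 \<le> s" "s \<le> 1" for s
        proof -
          have sV: "x + s *\<^sub>R h \<in> V" using seg[OF that] d(2) by blast
          have "((\<lambda>s. G (x + s *\<^sub>R h) w) has_derivative (\<lambda>c. G' (x + s *\<^sub>R h) w (c *\<^sub>R h))) (at s)"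
            by (rule has_derivative_compose[where f = "\<lambda>s. x + s *\<^sub>R h" and f' = "\<lambda>c. c *\<^sub>R h",
                  OF _ G[OF sV w]]) (auto intro!: derivative_eq_intros)
          then show ?thesis
            unfolding has_field_derivative_def
            using linear_scale[OF lin[OF sV w]] by (simp add: mult_commute_abs)
        qed
        obtain s where s: "0 < s" "s < 1"
          "G (x + 1 *\<^sub>R h) w - G (x + 0 *\<^sub>R h) w = (1 - 0) * G' (x + s *\<^sub>R h) w h"
          using MVT2[of 0 1 "\<lambda>s. G (x + s *\<^sub>R h) w" "\<lambda>s. G' (x + s *\<^sub>R h) w h"] der by auto
        define z where "z = x + s *\<^sub>R h"
        have z: "z \<in> V" "\<And>b. b \<in> Basis \<Longrightarrow> z \<in> X b"
          using seg[of s] s d(2) unfolding z_def by auto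
        have rep: "G' p w h = (\<Sum>b\<in>Basis. (h \<bullet> b) * G' p w b)" if "p \<in> V" for p
          using linear_sum[OF lin[OF that w], of "\<lambda>b. (h \<bullet> b) *\<^sub>R b" Basis]
            linear_scale[OF lin[OF that w]] by (simp add: euclidean_representation)
        have "G y w - G x w - G' x w h = G' z w h - G' x w h"
          using s(3) by (simp add: z_def h_def)
        also have "\<dots> = (\<Sum>b\<in>Basis. (h \<bullet> b) * (G' z w b - G' x w b))"
          by (simp add: rep[OF z(1)] rep[OF x] sum_subtractf algebra_simps)
        also have "\<bar>\<dots>\<bar> \<le> (\<Sum>b\<in>(Basis::'a set). norm h * e')"
        proof (rule order_trans[OF sum_abs], rule sum_mono)
          fix b :: 'a assume b: "b \<in> Basis"
          have "\<bar>G' z w b - G' x w b\<bar> \<le> e'"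
            using X(3)[of z b w] z b w by (auto simp: dist_real_def)
          moreover have "\<bar>h \<bullet> b\<bar> \<le> norm h" using b by (rule Basis_le_norm)
          ultimately show "\<bar>(h \<bullet> b) * (G' z w b - G' x w b)\<bar> \<le> norm h * e'"
            unfolding abs_mult by (intro mult_mono) auto
        qed
        finally show ?thesis by (simp add: mult_ac)
      qed
      have "(LINT w:W|lborel. G y w) - (LINT w:W|lborel. G x w) - (LINT w:W|lborel. G' x w h)
          = (LINT w:W|lborel. G y w - G x w - G' x w h)"
        using set_integrable_compact[OF W contG[OF yV]] set_integrable_compact[OF W contG[OF x]] int
        by (simp add: set_integral_diff)
      also have "\<bar>\<dots>\<bar> \<le> real DIM('a) * e' * norm h * measure lborel W"
        using bound contG[OF yV] contG[OF x] c'[OF x]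
        by (intro abs_set_integral_le[OF W] continuous_intros) auto
      also have "\<dots> \<le> real DIM('a) * e' * norm h * (measure lborel W + 1)"
        using e' by (intro mult_left_mono) auto
      also have "\<dots> = e' * m * norm h" by (simp add: m_def mult_ac)
      also have "\<dots> = e * norm h" using m by (simp add: e'_def)
      finally show ?thesis by (simp add: h_def)
    qed
    then show "\<exists>d>0. \<forall>y. norm (y - x) < d \<longrightarrow>
        norm ((LINT w:W|lborel. G y w) - (LINT w:W|lborel. G x w) - (LINT w:W|lborel. G' x w (y - x)))
        \<le> e * norm (y - x)"
      using d(1) by blast
  qed
qed

text \<open>The parameter w is the pair (y, t), so that the integral over t and the average over y
  become one integral over the compact set of pairs.\<close>

definition cone_point :: "'a::real_vector \<Rightarrow> 'a \<times> real \<Rightarrow> 'a" where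
  "cone_point x w = fst w + snd w *\<^sub>R (x - fst w)"

text \<open>The tube lemma for the compact \<open>W\<close>. This set is the domain on which the
  averaged primitive is smooth.\<close>

lemma open_cone_points:
  fixes U :: "'a::euclidean_space set"
  assumes "compact W" "open U"
  shows "open {x. \<forall>w\<in>W. cone_point x w \<in> U}"
proof (subst open_subopen, intro ballI)
  fix x assume x: "x \<in> {x. \<forall>w\<in>W. cone_point x w \<in> U}"
  have "continuous_on UNIV (\<lambda>p. cone_point (fst p) (snd p :: 'a \<times> real))"
    unfolding cone_point_def by (intro continuous_intros)
  then have op: "open ((\<lambda>p. cone_point (fst p) (snd p)) -` U)"
    using assms(2) open_vimage by blast
  have "{x} \<times> W \<subseteq> (\<lambda>p. cone_point (fst p) (snd p)) -` U"
    using x by auto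
  then obtain X where "x \<in> X" "open X" "X \<times> W \<subseteq> (\<lambda>p. cone_point (fst p) (snd p)) -` U"
    using Elementary_Topology.tube_lemma[OF assms(1) op] by blast
  then show "\<exists>T. open T \<and> x \<in> T \<and> T \<subseteq> {x. \<forall>w\<in>W. cone_point x w \<in> U}"
    by (intro exI[of _ X]) (auto simp: subset_eq)
qed

lemma continuous_on_cone_point:
  fixes f :: "'a::real_normed_vector \<Rightarrow> 'b::topological_space"
  assumes "continuous_on U f" "\<And>x w. x \<in> V \<Longrightarrow> w \<in> W \<Longrightarrow> cone_point x w \<in> U"
  shows "continuous_on (V \<times> W) (\<lambda>(x, w). f (cone_point x w))"
proof -
  have "continuous_on (V \<times> W) (\<lambda>p. cone_point (fst p) (snd p))"
    unfolding cone_point_def by (intro continuous_intros)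
  then have "continuous_on (V \<times> W) (\<lambda>p. f (cone_point (fst p) (snd p)))"
    by (rule continuous_on_compose2[OF assms(1)]) (use assms(2) in auto)
  then show ?thesis by (simp add: split_beta)
qed

text \<open>Each derivative in x brings out a factor t = \<open>snd w\<close>, so the induction has
  to run over all continuous weights \<open>m\<close>.\<close>

lemma Ck_on_cone_integral:
  fixes f :: "'a::euclidean_space \<Rightarrow> real"
  assumes "open U" and W: "compact W"
  defines "V \<equiv> {x. \<forall>w\<in>W. cone_point x w \<in> U}"
  shows "Ck_on k U f \<Longrightarrow> continuous_on W m \<Longrightarrow> Ck_on k V (\<lambda>x. LINT w:W|lborel. m w * f (cone_point x w))"
proof (induction k arbitrary: f m)
  case 0
  have "continuous_on (V \<times> W) (\<lambda>(x, w). f (cone_point x w))"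
    using 0 by (intro continuous_on_cone_point[of U]) (auto simp: V_def)
  moreover have "continuous_on (V \<times> W) (\<lambda>p. m (snd p))"
    using 0(2) by (rule continuous_on_compose2) (auto intro!: continuous_intros)
  ultimately have "continuous_on (V \<times> W) (\<lambda>(x, w). m w * f (cone_point x w))"
    by (auto simp: split_beta intro!: continuous_intros)
  then show ?case using continuous_on_param_integral[OF W] by simp
next
  case (Suc k)
  have opV: "open V" unfolding V_def by (rule open_cone_points[OF W assms(1)])
  have m': "continuous_on W (\<lambda>w. m w * snd w)"
    using Suc.prems(2) by (intro continuous_intros)
  have m2: "continuous_on (V \<times> W) (\<lambda>p. m (snd p))"
    using Suc.prems(2) by (rule continuous_on_compose2) (auto intro!: continuous_intros)
  show ?case
  proof (rule Ck_on_SucI[OF opV])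
    fix x assume x: "x \<in> V"
    show "((\<lambda>x. LINT w:W|lborel. m w * f (cone_point x w)) has_derivative
        (\<lambda>v. LINT w:W|lborel. m w * snd w * frechet_derivative f (at (cone_point x w)) v)) (at x)"
    proof (rule has_derivative_param_integral[OF opV W x])
      fix x w assume "x \<in> V" "w \<in> W"
      then have z: "cone_point x w \<in> U" by (auto simp: V_def)
      note d = Ck_on_has_derivative[OF Suc.prems(1) z]
      have "((\<lambda>x. f (cone_point x w)) has_derivative
          (\<lambda>v. frechet_derivative f (at (cone_point x w)) (snd w *\<^sub>R v))) (at x)"
        by (rule has_derivative_compose[where f = "\<lambda>x. cone_point x w" and f' = "\<lambda>v. snd w *\<^sub>R v", OF _ d])
          (auto simp: cone_point_def intro!: derivative_eq_intros)
      then have "((\<lambda>x. m w * f (cone_point x w)) has_derivative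
          (\<lambda>v. m w * frechet_derivative f (at (cone_point x w)) (snd w *\<^sub>R v))) (at x)"
        by (rule has_derivative_mult_right)
      then show "((\<lambda>x. m w * f (cone_point x w)) has_derivative
          (\<lambda>v. m w * snd w * frechet_derivative f (at (cone_point x w)) v)) (at x)"
        using linear_scale[OF has_derivative_linear[OF d]] by (simp add: mult.assoc)
    next
      fix x assume x: "x \<in> V"
      have "continuous_on (V \<times> W) (\<lambda>(x, w). f (cone_point x w))"
        using Ck_on_continuous[OF Suc.prems(1)] by (intro continuous_on_cone_point[of U]) (auto simp: V_def)
      from continuous_on_param_section[OF this x]
      show "continuous_on W (\<lambda>w. m w * f (cone_point x w))"
        using Suc.prems(2) by (intro continuous_intros)
    next
      fix v
      have "continuous_on (V \<times> W) (\<lambda>(x, w). frechet_derivative f (at (cone_point x w)) v)"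
        using Ck_on_continuous[OF Ck_on_frechet_derivative[OF Suc.prems(1)]]
        by (intro continuous_on_cone_point[of U]) (auto simp: V_def)
      then show "continuous_on (V \<times> W) (\<lambda>(x, w). m w * snd w * frechet_derivative f (at (cone_point x w)) v)"
        using m2 by (auto simp: split_beta intro!: continuous_intros)
    qed
  next
    fix v
    show "Ck_on k V (\<lambda>x. LINT w:W|lborel. m w * snd w * frechet_derivative f (at (cone_point x w)) v)"
      by (intro Suc.IH m' Ck_on_frechet_derivative Suc.prems)
  qed
qed

subsection \<open>The averaged cone operator\<close>

lemma set_integral_sum_compact:
  fixes f :: "'i \<Rightarrow> 'b::euclidean_space \<Rightarrow> real"
  assumes "compact W" "\<And>i. i \<in> I \<Longrightarrow> continuous_on W (f i)"
  shows "(LINT w:W|lborel. \<Sum>i\<in>I. f i w) = (\<Sum>i\<in>I. LINT w:W|lborel. f i w)"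
  unfolding set_lebesgue_integral_def scaleR_sum_right
  by (rule Bochner_Integration.integral_sum) (use borel_integrable_compact assms in blast)

lemma set_integral_compact_cong:
  fixes f :: "'b::euclidean_space \<Rightarrow> real"
  shows "compact W \<Longrightarrow> (\<And>w. w \<in> W \<Longrightarrow> f w = g w) \<Longrightarrow> (LINT w:W|lborel. f w) = (LINT w:W|lborel. g w)"
  by (rule set_lebesgue_integral_cong) (auto simp: compact_imp_closed)

lemma linear_eq_sum_Basis:
  fixes f :: "'a::euclidean_space \<Rightarrow> real"
  assumes "linear f"
  shows "f u = (\<Sum>b\<in>Basis. (u \<bullet> b) * f b)"
  using linear_sum[OF assms, of "\<lambda>b. (u \<bullet> b) *\<^sub>R b" Basis] linear_scale[OF assms]
  by (simp add: euclidean_representation)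

text \<open>Here \<alpha> stands for d\<omega>, of degree r + 1. Inside the locale \<open>V\<close>
  is the open set on which all segments to \<open>K\<close> lie in \<open>U\<close>; in the
  estimates outside it denotes a volume.\<close>

locale averaged_homotopy =
  fixes U K :: "'a::euclidean_space set" and r :: nat and \<alpha> :: "'a form"
  assumes open_U: "open U" and compact_K: "compact K" and measure_K: "measure lborel K > 0"
    and covector_form: "\<And>z. z \<in> U \<Longrightarrow> covector (Suc r) (\<alpha> z)"
    and smooth_form: "\<And>k ws. Ck_on k U (\<lambda>z. \<alpha> z ws)"
    and closed_form: "\<And>z vs. z \<in> U \<Longrightarrow> ext_deriv \<alpha> z vs = 0"
begin

definition W where "W = K \<times> {0..1::real}"

definition V where "V = {x. \<forall>w\<in>W. cone_point x w \<in> U}"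

definition primitive :: "'a form" where
  "primitive x vs = (LINT w:W|lborel. snd w ^ r * \<alpha> (cone_point x w) ((x - fst w) # vs)) / measure lborel K"

definition \<alpha>' where "\<alpha>' z v ws = frechet_derivative (\<lambda>y. \<alpha> y ws) (at z) v"

lemma compact_W: "compact W"
  unfolding W_def by (intro compact_Times compact_K compact_Icc)

lemma open_V: "open V"
  unfolding V_def by (rule open_cone_points[OF compact_W open_U])

lemma cone_point_in: "x \<in> V \<Longrightarrow> w \<in> W \<Longrightarrow> cone_point x w \<in> U"
  by (auto simp: V_def)

lemma has_derivative_form: "z \<in> U \<Longrightarrow> ((\<lambda>y. \<alpha> y ws) has_derivative (\<lambda>v. \<alpha>' z v ws)) (at z)"
  unfolding \<alpha>'_def using Ck_on_has_derivative[OF smooth_form[of "Suc 0"]] by blast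

lemma form_basis: "z \<in> U \<Longrightarrow> \<alpha> z (u # ws) = (\<Sum>b\<in>Basis. (u \<bullet> b) * \<alpha> z (b # ws))"
  using linear_eq_sum_Basis[OF covector_linear_hd[OF covector_form]] by blast

lemma covector_deriv_form: "z \<in> U \<Longrightarrow> covector (Suc r) (\<alpha>' z v)"
  unfolding \<alpha>'_def
  by (intro covector_frechet_derivative[OF open_U] covector_form differentiableI[OF has_derivative_form])

lemma deriv_form_basis: "z \<in> U \<Longrightarrow> \<alpha>' z v (u # ws) = (\<Sum>b\<in>Basis. (u \<bullet> b) * \<alpha>' z v (b # ws))"
  using linear_eq_sum_Basis[OF covector_linear_hd[OF covector_deriv_form]] by blast

lemma continuous_form: "continuous_on (V \<times> W) (\<lambda>p. \<alpha> (cone_point (fst p) (snd p)) ws)"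
  using continuous_on_cone_point[where f = "\<lambda>z. \<alpha> z ws", OF Ck_on_continuous[OF smooth_form] cone_point_in]
  by (simp add: split_beta)

lemma continuous_deriv_form: "continuous_on (V \<times> W) (\<lambda>p. \<alpha>' (cone_point (fst p) (snd p)) v ws)"
  using continuous_on_cone_point[where f = "\<lambda>z. \<alpha>' z v ws",
      OF Ck_on_continuous[OF Ck_on_frechet_derivative[OF smooth_form, folded \<alpha>'_def]] cone_point_in]
  by (simp add: split_beta)

text \<open>The first argument x - y of \<alpha> varies with (x, w), while continuity and smoothness
  are given for fixed argument lists. Expanding x - y in the basis reduces everything to fixed
  lists.\<close>

definition integrand where
  "integrand ws x w = snd w ^ r * (\<Sum>b\<in>Basis. ((x - fst w) \<bullet> b) * \<alpha> (cone_point x w) (b # ws))"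

definition integrand_deriv where
  "integrand_deriv ws x w v = snd w ^ r * (\<Sum>b\<in>Basis. (v \<bullet> b) * \<alpha> (cone_point x w) (b # ws)
      + ((x - fst w) \<bullet> b) * (snd w * \<alpha>' (cone_point x w) v (b # ws)))"

lemma integrand_eq:
  "x \<in> V \<Longrightarrow> w \<in> W \<Longrightarrow> snd w ^ r * \<alpha> (cone_point x w) ((x - fst w) # ws) = integrand ws x w"
  by (simp add: integrand_def form_basis[OF cone_point_in, where u = "x - fst w"])

lemma integrand_deriv_eq:
  "x \<in> V \<Longrightarrow> w \<in> W \<Longrightarrow> integrand_deriv ws x w v
    = snd w ^ r * (\<alpha> (cone_point x w) (v # ws) + snd w * \<alpha>' (cone_point x w) v ((x - fst w) # ws))"
  by (simp add: integrand_deriv_def form_basis[OF cone_point_in, where u = v]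
      deriv_form_basis[OF cone_point_in, where u = "x - fst w"] sum.distrib sum_distrib_left mult_ac)

lemma continuous_integrand: "continuous_on (V \<times> W) (\<lambda>(x, w). integrand ws x w)"
  unfolding integrand_def split_beta by (intro continuous_intros continuous_form)

lemma continuous_integrand_deriv: "continuous_on (V \<times> W) (\<lambda>(x, w). integrand_deriv ws x w v)"
  unfolding integrand_deriv_def split_beta
  by (intro continuous_intros continuous_form continuous_deriv_form)

lemma primitive_eq:
  assumes "x \<in> V"
  shows "primitive x ws = (LINT w:W|lborel. integrand ws x w) / measure lborel K"
  unfolding primitive_def
  by (intro arg_cong2[where f = "(/)"] set_integral_compact_cong[OF compact_W] refl integrand_eq assms)

lemma has_derivative_integrand:
  assumes x: "x \<in> V" and w: "w \<in> W"
  shows "((\<lambda>x. integrand ws x w) has_derivative integrand_deriv ws x w) (at x)"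
proof -
  have z: "cone_point x w \<in> U" using cone_point_in assms by blast
  have d: "((\<lambda>x. \<alpha> (cone_point x w) us) has_derivative (\<lambda>v. snd w * \<alpha>' (cone_point x w) v us)) (at x)" for us
  proof -
    have "((\<lambda>x. \<alpha> (cone_point x w) us) has_derivative (\<lambda>v. \<alpha>' (cone_point x w) (snd w *\<^sub>R v) us)) (at x)"
      by (rule has_derivative_compose[where f = "\<lambda>x. cone_point x w" and f' = "\<lambda>v. snd w *\<^sub>R v",
            OF _ has_derivative_form[OF z]])
        (auto simp: cone_point_def intro!: derivative_eq_intros)
    then show ?thesis
      using linear_scale[OF has_derivative_linear[OF has_derivative_form[OF z]]] by simp
  qed
  show ?thesis
    unfolding integrand_def integrand_deriv_def[abs_def]
    by (rule derivative_eq_intros d refl | simp)+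
      (simp add: sum.distrib sum_distrib_left algebra_simps)
qed

lemma has_derivative_primitive:
  assumes x: "x \<in> V"
  shows "((\<lambda>x. primitive x ws) has_derivative
    (\<lambda>v. (LINT w:W|lborel. integrand_deriv ws x w v) / measure lborel K)) (at x)"
proof -
  have "((\<lambda>x. (LINT w:W|lborel. integrand ws x w) / measure lborel K) has_derivative
    (\<lambda>v. (LINT w:W|lborel. integrand_deriv ws x w v) / measure lborel K)) (at x)"
    using has_derivative_param_integral[OF open_V compact_W x has_derivative_integrand
        continuous_on_param_section[OF continuous_integrand] continuous_integrand_deriv]
    by (intro bounded_linear.has_derivative[OF bounded_linear_divide]) auto
  then show ?thesis
    by (rule has_derivative_transform_within_open[OF _ open_V x]) (simp add: primitive_eq)
qed

lemma Ck_on_primitive: "Ck_on k V (\<lambda>x. primitive x vs)"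
proof -
  define J where "J m b x = (LINT w:W|lborel. m w * \<alpha> (cone_point x w) (b # vs))" for m b x
  \<comment> \<open>Splitting (x - y) \<bullet> b into x \<bullet> b and y \<bullet> b moves the
    dependence on x out of the weight: what remains are integrals as in
    \<open>Ck_on_cone_integral\<close>, with weights t^r and -t^r (y \<bullet> b).\<close>
  define m\<^sub>0 :: "'a \<times> real \<Rightarrow> real" where "m\<^sub>0 w = snd w ^ r" for w
  define m\<^sub>1 :: "'a \<Rightarrow> 'a \<times> real \<Rightarrow> real" where "m\<^sub>1 b w = - (snd w ^ r * (fst w \<bullet> b))" for b w
  have cont: "continuous_on W m\<^sub>0" "continuous_on W (m\<^sub>1 b)" for b
    unfolding m\<^sub>0_def m\<^sub>1_def by (intro continuous_intros)+
  have J: "Ck_on k V (J m b)" if "continuous_on W m" for m b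
    unfolding J_def V_def by (rule Ck_on_cone_integral[OF open_U compact_W smooth_form that])
  have eq: "(\<Sum>b\<in>Basis. (x \<bullet> b) * J m\<^sub>0 b x + J (m\<^sub>1 b) b x) * inverse (measure lborel K) = primitive x vs"
    if x: "x \<in> V" for x
  proof -
    have c: "continuous_on W (\<lambda>w. \<alpha> (cone_point x w) ws)" for ws
      by (rule continuous_on_param_section[where G = "\<lambda>x w. \<alpha> (cone_point x w) ws", OF _ x])
        (use continuous_form in \<open>simp add: split_beta\<close>)
    have "(LINT w:W|lborel. integrand vs x w)
      = (LINT w:W|lborel. \<Sum>b\<in>Basis. (x \<bullet> b) * (m\<^sub>0 w * \<alpha> (cone_point x w) (b # vs))
          + m\<^sub>1 b w * \<alpha> (cone_point x w) (b # vs))"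
      by (intro set_integral_compact_cong compact_W)
        (simp add: integrand_def m\<^sub>0_def m\<^sub>1_def sum_distrib_left inner_diff_left algebra_simps)
    also have "\<dots> = (\<Sum>b\<in>Basis. LINT w:W|lborel. (x \<bullet> b) * (m\<^sub>0 w * \<alpha> (cone_point x w) (b # vs))
          + m\<^sub>1 b w * \<alpha> (cone_point x w) (b # vs))"
      by (intro set_integral_sum_compact compact_W continuous_intros cont c)
    also have "\<dots> = (\<Sum>b\<in>Basis. (x \<bullet> b) * J m\<^sub>0 b x + J (m\<^sub>1 b) b x)"
      unfolding J_def
      by (intro sum.cong refl, subst set_integral_add)
        (auto intro!: set_integrable_compact compact_W continuous_intros cont c)
    finally show ?thesis by (simp add: primitive_eq[OF x] divide_inverse)
  qed
  show ?thesis
    by (rule Ck_on_cong[OF open_V eq], assumption)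
      (intro Ck_on_mult Ck_on_sum Ck_on_add Ck_on_const Ck_on_inner_right open_V J cont)
qed

lemma covector_primitive:
  assumes x: "x \<in> V"
  shows "covector r (primitive x)"
proof -
  define G where "G w vs = snd w ^ r * \<alpha> (cone_point x w) ((x - fst w) # vs)" for w vs
  have cov: "covector r (G w)" if "w \<in> W" for w
    unfolding G_def by (intro covector_scale covector_Cons covector_form cone_point_in x that)
  have int: "set_integrable lborel W (\<lambda>w. G w vs)" for vs
  proof -
    have "set_integrable lborel W (integrand vs x)"
      by (intro set_integrable_compact compact_W continuous_on_param_section[OF continuous_integrand x])
    then show ?thesis
      using integrand_eq[OF x] compact_W
      by (subst set_integrable_cong[where f' = "integrand vs x"]) (auto simp: G_def)
  qed
  have prim: "primitive x vs = (LINT w:W|lborel. G w vs) / measure lborel K" for vs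
    by (simp add: primitive_def G_def)
  have zero: "primitive x vs = 0" if "\<And>w. w \<in> W \<Longrightarrow> G w vs = 0" for vs
    using set_integral_compact_cong[OF compact_W that] by (simp add: prim)
  show ?thesis
    unfolding covector_def
  proof (intro conjI allI impI)
    fix vs :: "'a list" and i assume i: "length vs = r \<and> i < r"
    have lin: "linear (\<lambda>v. G w (vs[i := v]))" if "w \<in> W" for w
      using covector_linear[OF cov[OF that]] i by blast
    show "linear (\<lambda>v. primitive x (vs[i := v]))"
    proof (rule linearI)
      fix a b c
      have "(LINT w:W|lborel. G w (vs[i := a + b])) = (LINT w:W|lborel. G w (vs[i := a]) + G w (vs[i := b]))"
        by (intro set_integral_compact_cong compact_W) (simp add: linear_add[OF lin])
      then show "primitive x (vs[i := a + b]) = primitive x (vs[i := a]) + primitive x (vs[i := b])"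
        using int by (simp add: prim set_integral_add add_divide_distrib)
      have "(LINT w:W|lborel. G w (vs[i := c *\<^sub>R a])) = (LINT w:W|lborel. c * G w (vs[i := a]))"
        by (intro set_integral_compact_cong compact_W) (simp add: linear_scale[OF lin])
      then show "primitive x (vs[i := c *\<^sub>R a]) = c *\<^sub>R primitive x (vs[i := a])"
        by (simp add: prim)
    qed
  qed (use covector_not_distinct[OF cov] covector_length[OF cov] in \<open>auto intro!: zero\<close>)
qed

text \<open>With z = y + t(x - y) and u = x - y, closedness of \<alpha> turns d of the integrand
  into t^r ((r+1) \<alpha> + t D\<alpha>[u]) at z, which is the t-derivative of t^(r+1) \<alpha>(z).
  For each y the integral over t is therefore \<alpha>(x), and so is the average over y.\<close>

lemma ext_deriv_primitive:
  assumes x: "x \<in> V"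
  shows "ext_deriv primitive x = \<alpha> x"
proof (cases "K = {}")
  case True
  then show ?thesis using measure_K by simp
next
  case False
  then obtain y\<^sub>0 where y\<^sub>0: "y\<^sub>0 \<in> K" by auto
  have "x \<in> U"
    using cone_point_in[OF x, of "(y\<^sub>0, 1)"] y\<^sub>0 by (simp add: W_def cone_point_def)
  have "ext_deriv primitive x vs = \<alpha> x vs" if len: "length vs = Suc r" for vs
  proof -
    define H where "H w = snd w ^ r * (real (Suc r) * \<alpha> (cone_point x w) vs
        + snd w * \<alpha>' (cone_point x w) (x - fst w) vs)" for w
    have "ext_deriv primitive x vs = (\<Sum>i<length vs. (-1) ^ i *
        ((LINT w:W|lborel. integrand_deriv (take i vs @ drop (Suc i) vs) x w (vs ! i)) / measure lborel K))"
      unfolding ext_deriv_def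
      by (intro sum.cong refl) (simp add: frechet_derivative_eqI[OF has_derivative_primitive[OF x]])
    also have "\<dots> = (\<Sum>i<length vs. (LINT w:W|lborel.
        (-1) ^ i * integrand_deriv (take i vs @ drop (Suc i) vs) x w (vs ! i))) / measure lborel K"
      by (simp add: sum_divide_distrib)
    also have "(\<Sum>i<length vs. (LINT w:W|lborel. (-1) ^ i * integrand_deriv (take i vs @ drop (Suc i) vs) x w (vs ! i)))
        = (LINT w:W|lborel. \<Sum>i<length vs. (-1) ^ i * integrand_deriv (take i vs @ drop (Suc i) vs) x w (vs ! i))"
      by (intro set_integral_sum_compact[symmetric] compact_W continuous_intros
          continuous_on_param_section[OF continuous_integrand_deriv x])
    also have "\<dots> = (LINT w:W|lborel. H w)"
    proof (rule set_integral_compact_cong[OF compact_W])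
      fix w assume w: "w \<in> W"
      define z u where "z = cone_point x w" and "u = x - fst w"
      have z: "z \<in> U" unfolding z_def by (rule cone_point_in[OF x w])
      have "(\<Sum>i<length vs. (-1) ^ i * integrand_deriv (take i vs @ drop (Suc i) vs) x w (vs ! i))
          = snd w ^ r * (alternation (\<lambda>v ws. \<alpha> z (v # ws)) vs + snd w * alternation (\<lambda>v ws. \<alpha>' z v (u # ws)) vs)"
        by (simp add: integrand_deriv_eq[OF x w] alternation_def z_def u_def sum.distrib sum_distrib_left algebra_simps)
      moreover have "alternation (\<lambda>v ws. \<alpha> z (v # ws)) vs = real (Suc r) * \<alpha> z vs"
        using alternation_covector[OF covector_form[OF z]] len by simp
      \<comment> \<open>Cartan's formula for d\<alpha> = 0, contracted with u.\<close>
      moreover have "alternation (\<lambda>v ws. \<alpha>' z v (u # ws)) vs = \<alpha>' z u vs"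
        using closed_form[OF z, of "u # vs"] unfolding ext_deriv_Cons
        by (simp add: ext_deriv_eq_alternation \<alpha>'_def)
      ultimately show "(\<Sum>i<length vs. (-1) ^ i * integrand_deriv (take i vs @ drop (Suc i) vs) x w (vs ! i)) = H w"
        by (simp add: H_def z_def u_def)
    qed
    also have "\<dots> = measure lborel K * \<alpha> x vs"
    proof -
      have contH: "continuous_on W H"
      proof -
        have c: "continuous_on W (\<lambda>w. \<alpha> (cone_point x w) ws)" for ws
          by (rule continuous_on_param_section[where G = "\<lambda>x w. \<alpha> (cone_point x w) ws", OF _ x])
            (use continuous_form in \<open>simp add: split_beta\<close>)
        have c': "continuous_on W (\<lambda>w. \<alpha>' (cone_point x w) v ws)" for v ws
          by (rule continuous_on_param_section[where G = "\<lambda>x w. \<alpha>' (cone_point x w) v ws", OF _ x])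
            (use continuous_deriv_form in \<open>simp add: split_beta\<close>)
        \<comment> \<open>The direction x - y varies with w, whereas continuity is known for fixed
          directions; the basis expansion separates the two.\<close>
        have "continuous_on W (\<lambda>w. snd w ^ r * (real (Suc r) * \<alpha> (cone_point x w) vs
          + snd w * (\<Sum>b\<in>Basis. ((x - fst w) \<bullet> b) * \<alpha>' (cone_point x w) b vs)))"
          by (intro continuous_intros c c')
        moreover have "\<alpha>' (cone_point x w) v vs = (\<Sum>b\<in>Basis. (v \<bullet> b) * \<alpha>' (cone_point x w) b vs)"
          if "w \<in> W" for v w
          by (rule linear_eq_sum_Basis[OF has_derivative_linear[OF has_derivative_form[OF cone_point_in[OF x that]]]])
        ultimately show ?thesis
          unfolding H_def by (subst continuous_on_cong[OF refl]) auto
      qed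
      have inner: "(LINT t|lborel. indicator W (y, t) *\<^sub>R H (y, t)) = indicator K y *\<^sub>R \<alpha> x vs" for y
      proof (cases "y \<in> K")
        case True
        have "(LINT t|lborel. indicator W (y, t) *\<^sub>R H (y, t)) = (LINT t|lborel. indicator {0..1} t *\<^sub>R H (y, t))"
          using True by (intro Bochner_Integration.integral_cong) (auto simp: W_def indicator_def)
        \<comment> \<open>The exponent is r + 1 and not r, so the lower endpoint contributes nothing
          even for r = 0.\<close>
        also have "\<dots> = 1 ^ Suc r * \<alpha> (cone_point x (y, 1)) vs - 0 ^ Suc r * \<alpha> (cone_point x (y, 0)) vs"
        proof (rule integral_FTC_atLeastAtMost)
          show "continuous_on {0..1} (\<lambda>t. H (y, t))"
            using True by (intro continuous_on_compose2[OF contH] continuous_intros) (auto simp: W_def)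
          fix t :: real assume "0 \<le> t" "t \<le> 1"
          then have z: "cone_point x (y, t) \<in> U" using cone_point_in[OF x] True by (simp add: W_def)
          have "((\<lambda>t. \<alpha> (cone_point x (y, t)) vs) has_derivative
              (\<lambda>c. \<alpha>' (cone_point x (y, t)) (c *\<^sub>R (x - y)) vs)) (at t)"
            by (rule has_derivative_compose[where f = "\<lambda>t. cone_point x (y, t)" and f' = "\<lambda>c. c *\<^sub>R (x - y)",
                  OF _ has_derivative_form[OF z]])
              (auto simp: cone_point_def intro!: derivative_eq_intros)
          then have "((\<lambda>t. \<alpha> (cone_point x (y, t)) vs) has_real_derivative \<alpha>' (cone_point x (y, t)) (x - y) vs) (at t)"
            using linear_scale[OF has_derivative_linear[OF has_derivative_form[OF z]]]
            by (simp add: has_field_derivative_def mult_commute_abs)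
          then have "((\<lambda>t. t ^ Suc r * \<alpha> (cone_point x (y, t)) vs) has_real_derivative H (y, t)) (at t)"
            by - (rule derivative_eq_intros | assumption | simp add: H_def algebra_simps)+
          then show "((\<lambda>t. t ^ Suc r * \<alpha> (cone_point x (y, t)) vs) has_vector_derivative H (y, t)) (at t within {0..1})"
            using has_vector_derivative_at_within has_real_derivative_iff_has_vector_derivative by blast
        qed simp
        finally show ?thesis using True by (simp add: cone_point_def)
      qed (auto simp: W_def)
      have "integrable (lborel \<Otimes>\<^sub>M lborel) (\<lambda>w. indicator W w *\<^sub>R H w)"
        unfolding lborel_prod by (rule borel_integrable_compact[OF compact_W contH])
      then have "(LINT y|lborel. LINT t|lborel. indicator W (y, t) *\<^sub>R H (y, t))
          = (LINT w|(lborel \<Otimes>\<^sub>M lborel). indicator W w *\<^sub>R H w)"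
        by (rule lborel_pair.integral_fst')
      then have "(LINT w:W|lborel. H w) = (LINT y|lborel. indicator K y *\<^sub>R \<alpha> x vs)"
        unfolding inner lborel_prod set_lebesgue_integral_def by simp
      then show ?thesis
        using compact_K emeasure_compact_finite[OF compact_K] by (simp add: compact_imp_closed)
    qed
    finally show ?thesis using measure_K by simp
  qed
  \<comment> \<open>Equality of covectors is equality on all lists; on lists of the wrong length
    both sides are 0.\<close>
  moreover have cov: "covector (Suc r) (ext_deriv primitive x)"
    by (rule covector_ext_deriv[OF open_V x covector_primitive differentiableI[OF has_derivative_primitive[OF x]]])
  ultimately show ?thesis
    using covector_length[OF cov] covector_length[OF covector_form[OF \<open>x \<in> U\<close>]]
    by (intro ext) metis
qed

end

subsection \<open>Powers of extended nonnegative numbers and the slice estimate\<close>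

text \<open>The same convention at \<infinity> as in \<open>Lp_norm\<close>, so that inner integrals
  can be raised to a power before they are known to be finite.\<close>

definition epowr :: "ennreal \<Rightarrow> real \<Rightarrow> ennreal" where
  "epowr x p = (if x = \<infinity> then \<infinity> else ennreal (enn2real x powr p))"

lemma measurable_epowr [measurable]:
  assumes [measurable]: "f \<in> borel_measurable M"
  shows "(\<lambda>x. epowr (f x) p) \<in> borel_measurable M"
  unfolding epowr_def by measurable

lemma epowr_ennreal [simp]: "x \<ge> 0 \<Longrightarrow> epowr (ennreal x) p = ennreal (x powr p)"
  by (simp add: epowr_def)

lemma epowr_top [simp]: "epowr top p = top"
  by (simp add: epowr_def)

lemma epowr_0 [simp]: "epowr 0 p = 0"
  by (simp add: epowr_def)

lemma epowr_mono: "p > 0 \<Longrightarrow> x \<le> y \<Longrightarrow> epowr x p \<le> epowr y p"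
  by (cases x; cases y) (auto intro: powr_mono2 simp: top_unique)

lemma epowr_mult:
  assumes "p > 0"
  shows "epowr (x * y) p = epowr x p * epowr y p"
proof -
  have *: "epowr (top * y) p = epowr top p * epowr y p" for y
    by (cases "y = 0"; cases y) (auto simp: ennreal_top_mult)
  show ?thesis
  proof (cases "x = top \<or> y = top")
    case True
    then show ?thesis using *[of x] *[of y] by (metis mult.commute)
  next
    case False
    then show ?thesis
      by (cases x; cases y) (auto simp: ennreal_mult[symmetric] powr_mult)
  qed
qed

lemma epowr_epowr: "p > 0 \<Longrightarrow> epowr (epowr x p) q = epowr x (p * q)"
  by (cases x) (auto simp: powr_powr)

text \<open>The graph of x^p lies above its tangent at s. For positive s and x this is Young's
  inequality with exponents p and p/(p-1).\<close>

lemma tangent_powr: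
  fixes p s x :: real
  assumes "p \<ge> 1" "s \<ge> 0" "x \<ge> 0"
  shows "p * s powr (p - 1) * x \<le> x powr p + (p - 1) * s powr p"
proof (cases "s = 0 \<or> x = 0")
  case False
  then have "(x powr p) powr (1 / p) * (s powr p) powr ((p - 1) / p)
      \<le> (1 / p) * x powr p + ((p - 1) / p) * s powr p"
    using assms by (intro Youngs_inequality_0) (auto simp: field_simps)
  then have "x * s powr (p - 1) \<le> (x powr p + (p - 1) * s powr p) / p"
    using False assms by (simp add: powr_powr add_divide_distrib)
  then show ?thesis
    using assms by (simp add: field_simps)
qed (use assms in auto)

text \<open>Jensen's inequality for a weight of total mass m, whence the factor m^(p-1). The tangent
  inequality is integrated against the weight; the tangent at the weighted mean of f gives the
  claim.\<close>

lemma epowr_nn_integral_le: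
  fixes f :: "'a \<Rightarrow> ennreal" and w :: "'a \<Rightarrow> real"
  assumes [measurable]: "f \<in> borel_measurable M" "w \<in> borel_measurable M"
    and m: "(\<integral>\<^sup>+x. ennreal (w x) \<partial>M) = ennreal m" "m > 0" and p: "p \<ge> 1"
  shows "epowr (\<integral>\<^sup>+x. f x * ennreal (w x) \<partial>M) p
    \<le> ennreal (m powr (p - 1)) * (\<integral>\<^sup>+x. epowr (f x) p * ennreal (w x) \<partial>M)"
proof (cases "(\<integral>\<^sup>+x. epowr (f x) p * ennreal (w x) \<partial>M)")
  case top
  then show ?thesis using m(2) by (simp add: ennreal_mult_top)
next
  case (real I)
  have tangent: "ennreal (p * s powr (p - 1)) * y \<le> epowr y p + ennreal ((p - 1) * s powr p)"
    if "s \<ge> 0" for y s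
  proof (cases y)
    case (real x)
    then show ?thesis using tangent_powr[OF p that, of x] p that
      by (simp add: ennreal_mult[symmetric] ennreal_plus[symmetric] del: ennreal_plus)
  qed simp
  have int: "ennreal (p * s powr (p - 1)) * (\<integral>\<^sup>+x. f x * ennreal (w x) \<partial>M)
      \<le> ennreal I + ennreal ((p - 1) * s powr p * m)" if s: "s \<ge> 0" for s
  proof -
    have "ennreal (p * s powr (p - 1)) * (\<integral>\<^sup>+x. f x * ennreal (w x) \<partial>M)
        = (\<integral>\<^sup>+x. ennreal (p * s powr (p - 1)) * f x * ennreal (w x) \<partial>M)"
      by (subst nn_integral_cmult[symmetric]) (auto simp: mult.assoc)
    also have "\<dots> \<le> (\<integral>\<^sup>+x. epowr (f x) p * ennreal (w x) + ennreal ((p - 1) * s powr p) * ennreal (w x) \<partial>M)"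
      by (intro nn_integral_mono) (metis tangent[OF s] distrib_right mult_right_mono zero_le)
    also have "\<dots> = ennreal I + ennreal ((p - 1) * s powr p * m)"
      using real m p by (simp add: nn_integral_add nn_integral_cmult ennreal_mult)
    finally show ?thesis .
  qed
  \<comment> \<open>The tangent at s = 1 already shows that the integral of f is finite, so that its
    mean can be formed.\<close>
  obtain S where S: "S \<ge> 0" "(\<integral>\<^sup>+x. f x * ennreal (w x) \<partial>M) = ennreal S"
  proof (cases "(\<integral>\<^sup>+x. f x * ennreal (w x) \<partial>M)")
    case top
    then show ?thesis
      using int[of 1] p by (simp add: ennreal_mult_top top_unique)
  qed (use that in blast)
  define s where "s = S / m"
  have s: "s \<ge> 0" "S = s * m" using S m by (auto simp: s_def)
  have "p * s powr (p - 1) * S \<le> I + (p - 1) * s powr p * m"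
    using int[OF s(1)] S s m p real(1)
    by (simp add: ennreal_mult[symmetric] ennreal_plus[symmetric] del: ennreal_plus)
  moreover have "s powr (p - 1) * S = s powr p * m"
    using s p by (cases "s = 0") (auto simp: powr_diff)
  ultimately have "p * (s powr p * m) \<le> I + (p - 1) * (s powr p * m)"
    by (simp only: mult.assoc)
  then have "s powr p * m \<le> I" by (simp add: left_diff_distrib)
  then have "m powr (p - 1) * (s powr p * m) \<le> m powr (p - 1) * I"
    by (rule mult_left_mono) simp
  moreover have "m powr (p - 1) * (s powr p * m) = S powr p"
    using s m by (simp add: powr_mult powr_diff)
  ultimately show ?thesis
    using S real by (simp add: ennreal_mult[symmetric])
qed

section \<open>Affine substitutions and the estimate for fixed t\<close>

lemma nn_integral_lborel_affine:
  fixes f :: "'a::euclidean_space \<Rightarrow> ennreal"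
  assumes [measurable]: "f \<in> borel_measurable borel" and c: "c > 0"
  shows "(\<integral>\<^sup>+y. f (a + c *\<^sub>R y) \<partial>lborel) = ennreal (c powr - real DIM('a)) * (\<integral>\<^sup>+y. f y \<partial>lborel)"
proof -
  have "(\<integral>\<^sup>+y. f y \<partial>lborel) = (\<integral>\<^sup>+y. f y \<partial>density (distr lborel borel (\<lambda>x. a + c *\<^sub>R x)) (\<lambda>_. \<bar>c\<bar>^DIM('a)))"
    using lborel_affine[of c a] c by simp
  also have "\<dots> = ennreal (c ^ DIM('a)) * (\<integral>\<^sup>+y. f (a + c *\<^sub>R y) \<partial>lborel)"
    using c by (simp add: nn_integral_density nn_integral_distr nn_integral_cmult)
  finally show ?thesis
    using c by (simp add: mult.assoc[symmetric] ennreal_mult[symmetric] powr_minus powr_realpow)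
qed

text \<open>The point is a dilation of y by 1 - t and a dilation of x by t; each form matches the
  affine substitution in its last variable.\<close>

lemma cone_point_affine:
  "cone_point x (y, t) = t *\<^sub>R x + (1 - t) *\<^sub>R y" "cone_point x (y, t) = (1 - t) *\<^sub>R y + t *\<^sub>R x"
  by (simp_all add: cone_point_def algebra_simps)

lemma measurable_cone_point [measurable]:
  "(\<lambda>p. cone_point (f p) (g p, h p)) \<in> borel_measurable M"
  if [measurable]: "f \<in> borel_measurable M" "g \<in> borel_measurable M" "h \<in> borel_measurable M"
  for f g :: "'b \<Rightarrow> 'a::euclidean_space" and h :: "'b \<Rightarrow> real"
  unfolding cone_point_affine(1) by (intro borel_measurable_add borel_measurable_scaleR borel_measurable_diff borel_measurable_const that)

text \<open>With g the inner integral, Jensen in y gives g^q \<le> V^(q-1) H. Raising to p/q and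
  using H \<le> L gives g^p \<le> c H, so only the integral of H over S remains. The factor \<mu> is
  left open to allow the better of two bounds for that integral.\<close>

lemma slice_estimate:
  fixes F :: "'a::euclidean_space \<Rightarrow> real" and S :: "'a set"
  assumes F [measurable]: "F \<in> borel_measurable borel" and F0: "\<And>x. F x \<ge> 0"
    and S [measurable]: "S \<in> sets borel" and V: "emeasure lborel S = ennreal V" "V > 0"
    and N: "(\<integral>\<^sup>+z. ennreal (F z powr q) \<partial>lborel) = ennreal N" "N \<ge> 0"
    and pq: "q \<ge> 1" "p \<ge> q" and t: "0 < t" "t < 1"
    and \<mu>: "\<mu> = t powr - real DIM('a) \<or> \<mu> = (1 - t) powr - real DIM('a)"
  shows "(\<integral>\<^sup>+x. epowr (\<integral>\<^sup>+y. ennreal (F (cone_point x (y, t))) * indicator S y \<partial>lborel) p * indicator S x \<partial>lborel)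
    \<le> ennreal (V powr (p + 1 - p / q) * N powr (p / q) * (1 - t) powr (- real DIM('a) * (p / q - 1)) * \<mu>)"
proof -
  define H where "H x = (\<integral>\<^sup>+y. ennreal (F (cone_point x (y, t)) powr q) * indicator S y \<partial>lborel)" for x
  define g where "g x = (\<integral>\<^sup>+y. ennreal (F (cone_point x (y, t))) * indicator S y \<partial>lborel)" for x
  have [measurable]: "H \<in> borel_measurable lborel" "g \<in> borel_measurable lborel"
    unfolding H_def g_def by measurable
  define L where "L = (1 - t) powr - real DIM('a) * N"
  have L: "L \<ge> 0" using N by (simp add: L_def)
  have yint: "(\<integral>\<^sup>+y. ennreal (F (cone_point x (y, t)) powr q) \<partial>lborel) = ennreal L" for x
    unfolding cone_point_affine(1) L_def
    using nn_integral_lborel_affine[of "\<lambda>z. ennreal (F z powr q)" "1 - t" "t *\<^sub>R x"] t N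
    by (simp add: ennreal_mult)
  have xint: "(\<integral>\<^sup>+x. ennreal (F (cone_point x (y, t)) powr q) \<partial>lborel) = ennreal (t powr - real DIM('a) * N)" for y
    unfolding cone_point_affine(2)
    using nn_integral_lborel_affine[of "\<lambda>z. ennreal (F z powr q)" t "(1 - t) *\<^sub>R y"] t N
    by (simp add: ennreal_mult)
  have HL: "H x \<le> ennreal L" for x
    unfolding H_def yint[of x, symmetric] by (intro nn_integral_mono) (auto simp: indicator_def)
  have const: "(\<integral>\<^sup>+x. ennreal k * indicator S x \<partial>lborel) = ennreal (V * k)" if "k \<ge> 0" for k
    using that V by (simp add: nn_integral_cmult_indicator ennreal_mult[symmetric] mult.commute[of V])
  have \<mu>0: "\<mu> \<ge> 0" using \<mu> by auto
  have Hint: "(\<integral>\<^sup>+x. H x * indicator S x \<partial>lborel) \<le> ennreal (V * (\<mu> * N))"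
    using \<mu>
  proof
    assume "\<mu> = (1 - t) powr - real DIM('a)"
    then have "(\<integral>\<^sup>+x. H x * indicator S x \<partial>lborel) \<le> (\<integral>\<^sup>+x. ennreal (\<mu> * N) * indicator S x \<partial>lborel)"
      using HL by (intro nn_integral_mono mult_right_mono) (auto simp: L_def)
    also have "\<dots> = ennreal (V * (\<mu> * N))"
      using \<mu>0 N by (intro const) simp
    finally show ?thesis .
  next
    \<comment> \<open>Enlarging the x-domain from \<open>S\<close> to the whole space permits
      integrating over x first, for fixed y.\<close>
    assume \<mu>: "\<mu> = t powr - real DIM('a)"
    have "(\<integral>\<^sup>+x. H x * indicator S x \<partial>lborel) \<le> (\<integral>\<^sup>+x. H x \<partial>lborel)"
      by (intro nn_integral_mono) (auto simp: indicator_def)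
    also have "\<dots> = (\<integral>\<^sup>+y. (\<integral>\<^sup>+x. ennreal (F (cone_point x (y, t)) powr q) * indicator S y \<partial>lborel) \<partial>lborel)"
      unfolding H_def by (rule lborel_pair.Fubini') measurable
    also have "\<dots> = (\<integral>\<^sup>+y. ennreal (\<mu> * N) * indicator S y \<partial>lborel)"
      by (simp add: nn_integral_multc xint \<mu>)
    also have "\<dots> = ennreal (V * (\<mu> * N))"
      using \<mu>0 N by (intro const) simp
    finally show ?thesis .
  qed
  have pqpos: "q > 0" "p > 0" "p / q > 0" "p / q \<ge> 1" using pq by auto
  have indS: "(\<integral>\<^sup>+y. ennreal (indicator S y) \<partial>lborel) = ennreal V"
    using V by (simp add: ennreal_indicator)
  have gq: "epowr (g x) q \<le> ennreal (V powr (q - 1)) * H x" for x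
    using epowr_nn_integral_le[of "\<lambda>y. ennreal (F (cone_point x (y, t)))" lborel "indicator S" V q]
      indS V pq F0 by (simp add: g_def H_def ennreal_indicator)
  have Hp: "epowr (H x) (p / q) \<le> ennreal (L powr (p / q - 1)) * H x" for x
  proof (cases "H x")
    case (real h)
    then have "h \<le> L" using HL[of x] L by simp
    then have "h powr (p / q - 1) * h \<le> L powr (p / q - 1) * h"
      using real pqpos by (intro mult_right_mono powr_mono2) auto
    then have "h powr (p / q) \<le> L powr (p / q - 1) * h"
      using real by (cases "h = 0") (auto simp: powr_diff)
    then show ?thesis using real by (simp add: ennreal_mult[symmetric])
  next
    case top
    then show ?thesis using HL[of x] by (simp add: top_unique)
  qed
  define c where "c = (V powr (q - 1)) powr (p / q) * L powr (p / q - 1)"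
  have gp: "epowr (g x) p \<le> ennreal c * H x" for x
  proof -
    have "epowr (g x) p = epowr (epowr (g x) q) (p / q)"
      using pqpos by (simp add: epowr_epowr)
    also have "\<dots> \<le> epowr (ennreal (V powr (q - 1)) * H x) (p / q)"
      by (intro epowr_mono gq pqpos)
    also have "\<dots> = ennreal ((V powr (q - 1)) powr (p / q)) * epowr (H x) (p / q)"
      using pqpos by (simp add: epowr_mult)
    also have "\<dots> \<le> ennreal ((V powr (q - 1)) powr (p / q)) * (ennreal (L powr (p / q - 1)) * H x)"
      by (intro mult_left_mono Hp) auto
    finally show ?thesis by (simp add: c_def ennreal_mult mult.assoc)
  qed
  have "(\<integral>\<^sup>+x. epowr (g x) p * indicator S x \<partial>lborel) \<le> (\<integral>\<^sup>+x. ennreal c * (H x * indicator S x) \<partial>lborel)"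
    using gp by (intro nn_integral_mono) (auto simp: mult.assoc[symmetric] intro!: mult_right_mono)
  also have "\<dots> = ennreal c * (\<integral>\<^sup>+x. H x * indicator S x \<partial>lborel)"
    by (rule nn_integral_cmult) measurable
  also have "\<dots> \<le> ennreal c * ennreal (V * (\<mu> * N))"
    by (intro mult_left_mono Hint) auto
  also have "\<dots> = ennreal (c * (V * (\<mu> * N)))"
    by (rule ennreal_mult[symmetric]) (use V N \<mu> in \<open>auto simp: c_def\<close>)
  also have "c * (V * (\<mu> * N))
      = V powr (p + 1 - p / q) * N powr (p / q) * (1 - t) powr (- real DIM('a) * (p / q - 1)) * \<mu>"
  proof (cases "N = 0")
    case False
    then have "N > 0" using N by simp
    have "c = V powr (p - p / q) * ((1 - t) powr (- real DIM('a) * (p / q - 1)) * N powr (p / q - 1))"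
      unfolding c_def L_def using N pqpos by (simp add: powr_powr powr_mult field_simps)
    then have "c * (V * (\<mu> * N)) = (V powr (p - p / q) * V) * (N powr (p / q - 1) * N)
        * (1 - t) powr (- real DIM('a) * (p / q - 1)) * \<mu>"
      by (simp only: mult_ac)
    also have "N powr (p / q - 1) * N = N powr (p / q)"
      using \<open>N > 0\<close> by (simp add: powr_diff)
    also have "V powr (p - p / q) * V = V powr (p + 1 - p / q)"
      using V(2) by (simp add: powr_diff powr_add)
    finally show ?thesis .
  qed simp
  finally show ?thesis by (simp add: g_def)
qed

subsection \<open>The weight and the averaged estimate\<close>

text \<open>For 0 < t < 1 this equals t^r (1-t)^(n/p - n/q) times the smaller of t^(-n/p) and
  (1-t)^(-n/p).\<close>

definition cone_weight :: "real \<Rightarrow> real \<Rightarrow> nat \<Rightarrow> nat \<Rightarrow> real \<Rightarrow> real" where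
  "cone_weight p q r n t = min (t powr (real n / p)) ((1 - t) powr (real n / p))
      * t powr (real r - real n / p) * (1 - t) powr (- (real n / q))"

lemma cone_weight_pos: "0 < t \<Longrightarrow> t < 1 \<Longrightarrow> cone_weight p q r n t > 0"
  by (auto simp: cone_weight_def min_def)

lemma measurable_cone_weight [measurable]: "cone_weight p q r n \<in> borel_measurable borel"
  unfolding cone_weight_def by measurable

lemma cone_weight_cases:
  assumes "0 < t" "t < 1" "p > 0"
  shows "t \<le> 1 - t \<Longrightarrow> cone_weight p q r n t = t ^ r * (1 - t) powr (- (real n / q))"
    and "1 - t \<le> t \<Longrightarrow> cone_weight p q r n t = t ^ r * (t powr (- (real n / p)) * (1 - t) powr (real n / p - real n / q))"
proof -
  assume "t \<le> 1 - t"
  then have "min (t powr (real n / p)) ((1 - t) powr (real n / p)) = t powr (real n / p)"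
    using assms by (intro min_absorb1 powr_mono2) auto
  then show "cone_weight p q r n t = t ^ r * (1 - t) powr (- (real n / q))"
    using assms by (simp add: cone_weight_def powr_add[symmetric] powr_realpow)
next
  assume "1 - t \<le> t"
  then have "min (t powr (real n / p)) ((1 - t) powr (real n / p)) = (1 - t) powr (real n / p)"
    using assms by (intro min_absorb2 powr_mono2) auto
  then have "cone_weight p q r n t = t powr (real r - real n / p) * ((1 - t) powr (real n / p) * (1 - t) powr (- (real n / q)))"
    by (simp add: cone_weight_def mult_ac)
  also have "(1 - t) powr (real n / p) * (1 - t) powr (- (real n / q)) = (1 - t) powr (real n / p - real n / q)"
    by (simp add: powr_add[symmetric])
  also have "t powr (real r - real n / p) = t ^ r * t powr (- (real n / p))"
    using assms powr_add[of t "real r" "- (real n / p)"] by (simp add: powr_realpow)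
  finally show "cone_weight p q r n t = t ^ r * (t powr (- (real n / p)) * (1 - t) powr (real n / p - real n / q))"
    by (simp add: mult_ac)
qed

text \<open>The t-dependent factor of \<open>slice_estimate\<close>, with the smaller choice of
  \<mu>, is exactly the p-th power of the weight without t^r: \<mu> = (1-t)^(-n) for t \<le> 1/2 and
  t^(-n) beyond.\<close>

lemma cone_weight_powr:
  assumes t: "0 < t" "t < 1" and pq: "p > 0" "q > 0"
  obtains \<mu> where "\<mu> = t powr - real n \<or> \<mu> = (1 - t) powr - real n"
    and "(1 - t) powr (- real n * (p / q - 1)) * \<mu> = (cone_weight p q r n t / t ^ r) powr p"
proof (cases "t \<le> 1 - t")
  case True
  have "(cone_weight p q r n t / t ^ r) powr p = (1 - t) powr (- (real n / q) * p)"
    using t by (simp add: cone_weight_cases(1)[OF t pq(1) True] powr_powr)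
  also have "- (real n / q) * p = - real n * (p / q - 1) + - real n"
    using pq by (simp add: field_simps)
  finally show ?thesis
    by (intro that[of "(1 - t) powr - real n"]) (simp_all only: powr_add, simp)
next
  case False
  have "(cone_weight p q r n t / t ^ r) powr p
      = t powr (- (real n / p) * p) * (1 - t) powr ((real n / p - real n / q) * p)"
    using t False by (simp add: cone_weight_cases(2)[OF t pq(1)] powr_powr powr_mult)
  also have "(real n / p - real n / q) * p = - real n * (p / q - 1)"
    using pq by (simp add: field_simps)
  also have "- (real n / p) * p = - real n"
    using pq by simp
  finally show ?thesis
    by (intro that[of "t powr - real n"]) (simp_all only: mult.commute, simp)
qed

text \<open>On each half of the interval the factor with exponent -n/p has base at least 1/2, so the
  weight is at most 2^(n/p) (1-t)^s with s = n/p - n/q > -1. Positivity of the integral is needed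
  for Jensen and for the case of an infinite right-hand side.\<close>

lemma cone_weight_integral:
  assumes pq: "q \<ge> 1" "p \<ge> q" and n: "n > 0" "1 / q - 1 / p < 1 / real n"
  shows "(\<integral>\<^sup>+t. ennreal (cone_weight p q r n t * indicator {0<..<1} t) \<partial>lborel) = ennreal (Cconst p q r n)"
    and "Cconst p q r n > 0"
proof -
  define s where "s = real n / p - real n / q"
  have "real n * (1 / q - 1 / p) < real n * (1 / real n)"
    using n by (intro mult_strict_left_mono) auto
  then have s: "s > -1" using n by (simp add: s_def algebra_simps)
  have p0: "p > 0" "q > 0" using pq by auto
  have bound: "cone_weight p q r n t \<le> 2 powr (real n / p) * (1 - t) powr s" if t: "0 < t" "t < 1" for t
  proof (cases "t \<le> 1 - t")
    case True
    have "cone_weight p q r n t = t ^ r * (1 - t) powr (- (real n / q))"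
      by (rule cone_weight_cases(1)[OF t p0(1) True])
    also have "\<dots> \<le> 1 * (1 - t) powr (- (real n / q))"
      using t by (intro mult_right_mono power_le_one) auto
    also have "\<dots> = (1 - t) powr (- (real n / p)) * (1 - t) powr s"
      by (simp add: s_def powr_add[symmetric])
    also have "\<dots> \<le> 2 powr (real n / p) * (1 - t) powr s"
    proof (rule mult_right_mono)
      have "(1 - t) powr (- (real n / p)) \<le> (1 / 2) powr (- (real n / p))"
        using True t p0 by (intro powr_mono2') auto
      then show "(1 - t) powr (- (real n / p)) \<le> 2 powr (real n / p)"
        by (simp add: powr_minus powr_divide field_simps)
    qed simp
    finally show ?thesis .
  next
    case False
    then have "cone_weight p q r n t = t ^ r * (t powr (- (real n / p)) * (1 - t) powr s)"
      unfolding s_def by (intro cone_weight_cases(2)[OF t p0(1)]) simp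
    also have "\<dots> \<le> 1 * (t powr (- (real n / p)) * (1 - t) powr s)"
      using t by (intro mult_right_mono power_le_one) auto
    also have "\<dots> \<le> 2 powr (real n / p) * (1 - t) powr s"
      unfolding mult_1_left
    proof (rule mult_right_mono)
      have "t powr (- (real n / p)) \<le> (1 / 2) powr (- (real n / p))"
        using False t p0 by (intro powr_mono2') auto
      then show "t powr (- (real n / p)) \<le> 2 powr (real n / p)"
        by (simp add: powr_minus powr_divide field_simps)
    qed simp
    finally show ?thesis .
  qed
  define f where "f t = cone_weight p q r n t * indicator {0<..<1} t" for t
  have [measurable]: "f \<in> borel_measurable borel" unfolding f_def by measurable
  have f0: "f t \<ge> 0" for t
    using cone_weight_pos[of t p q r n] by (auto simp: f_def indicator_def less_imp_le)
  define h where "h t = t powr s * indicator {0..1} t" for t :: real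
  have [measurable]: "h \<in> borel_measurable borel" unfolding h_def by measurable
  have h0: "h t \<ge> 0" for t by (simp add: h_def)
  have "h = (\<lambda>t. if t \<in> {0..1} then t powr s else 0)"
    by (auto simp: h_def fun_eq_iff indicator_def)
  then have "(h has_integral (1 powr (s + 1) / (s + 1))) UNIV"
    using has_integral_powr_from_0[OF s, of 1] by (simp only: has_integral_restrict_UNIV)
  then have "(\<integral>\<^sup>+t. ennreal (h t) \<partial>lborel) = ennreal (1 powr (s + 1) / (s + 1))"
    by (rule nn_integral_has_integral_lborel[OF _ h0, rotated]) measurable
  moreover have "(\<integral>\<^sup>+t. ennreal (h t) \<partial>lborel) = (\<integral>\<^sup>+t. ennreal (h (1 - t)) \<partial>lborel)"
    using nn_integral_real_affine[of "\<lambda>t. ennreal (h t)" "-1" 1] by simp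
  ultimately have hfin: "(\<integral>\<^sup>+t. ennreal (h (1 - t)) \<partial>lborel) < \<infinity>" by simp
  have "(\<integral>\<^sup>+t. ennreal (f t) \<partial>lborel) \<le> (\<integral>\<^sup>+t. ennreal (2 powr (real n / p)) * ennreal (h (1 - t)) \<partial>lborel)"
  proof (rule nn_integral_mono)
    fix t :: real
    show "ennreal (f t) \<le> ennreal (2 powr (real n / p)) * ennreal (h (1 - t))"
      using bound[of t] by (auto simp: f_def h_def indicator_def ennreal_mult[symmetric])
  qed
  also have "\<dots> < \<infinity>" using hfin by (simp add: nn_integral_cmult ennreal_mult_less_top)
  finally obtain I where I: "I \<ge> 0" "(\<integral>\<^sup>+t. ennreal (f t) \<partial>lborel) = ennreal I"
    by (cases "(\<integral>\<^sup>+t. ennreal (f t) \<partial>lborel)") auto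
  have "(f has_integral I) UNIV"
    using nn_integral_has_integral[OF _ f0 I(2,1)] by simp
  \<comment> \<open>The weight is 0 at both endpoints because \<open>0 powr a = 0\<close>, so the
    open and the closed interval give the same function.\<close>
  moreover have "f = (\<lambda>t. if t \<in> {0..1} then cone_weight p q r n t else 0)"
    by (auto simp: f_def fun_eq_iff indicator_def cone_weight_def)
  ultimately have "(cone_weight p q r n has_integral I) {0..1}"
    by (simp only: has_integral_restrict_UNIV)
  then have C: "Cconst p q r n = I"
    using pq by (simp add: Cconst_def cone_weight_def[abs_def] integral_unique)
  show "(\<integral>\<^sup>+t. ennreal (cone_weight p q r n t * indicator {0<..<1} t) \<partial>lborel) = ennreal (Cconst p q r n)"
    using I C by (simp add: f_def)
  have "I \<noteq> 0"
  proof
    assume "I = 0"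
    then have "AE t in lborel. ennreal (f t) = 0"
      using I(2) by (subst nn_integral_0_iff_AE[symmetric]) auto
    then have "AE t in lborel. t \<notin> {0<..<1::real}"
    proof eventually_elim
      case (elim t)
      then show ?case using cone_weight_pos[of t p q r n] f0[of t]
        by (auto simp: f_def)
    qed
    moreover have "{t \<in> space lborel. \<not> t \<notin> {0<..<1::real}} = {0<..<1}" by auto
    ultimately have "emeasure lborel {0<..<1::real} = 0"
      using AE_iff_measurable[of "{0<..<1}" lborel "\<lambda>t::real. t \<notin> {0<..<1}"] by simp
    then show False by simp
  qed
  then show "Cconst p q r n > 0" using C I(1) by simp
qed

text \<open>Write t^r = k w with w the cone weight, of mass C. Jensen in t costs C^(p-1). After
  Fubini, \<open>slice_estimate\<close> bounds the x-integral at t by A w(t), since k^p cancels the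
  p-th power from \<open>cone_weight_powr\<close>; integrating w gives the last factor C.\<close>

lemma averaged_estimate:
  fixes F :: "'a::euclidean_space \<Rightarrow> real" and S :: "'a set"
  assumes F [measurable]: "F \<in> borel_measurable borel" and F0: "\<And>x. F x \<ge> 0"
    and S [measurable]: "S \<in> sets borel" and V: "emeasure lborel S = ennreal V" "V > 0"
    and N: "(\<integral>\<^sup>+z. ennreal (F z powr q) \<partial>lborel) = ennreal N" "N \<ge> 0"
    and pq: "q \<ge> 1" "p \<ge> q" "1 / q - 1 / p < 1 / real DIM('a)"
  shows "(\<integral>\<^sup>+x. epowr (\<integral>\<^sup>+t. (\<integral>\<^sup>+y. ennreal (F (cone_point x (y, t))) * indicator S y \<partial>lborel)
        * (ennreal (t ^ r) * indicator {0<..<1} t) \<partial>lborel) p * indicator S x \<partial>lborel)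
    \<le> ennreal (Cconst p q r DIM('a) powr p * (V powr (p + 1 - p / q) * N powr (p / q)))"
proof -
  define g where "g t x = (\<integral>\<^sup>+y. ennreal (F (cone_point x (y, t))) * indicator S y \<partial>lborel)" for t x
  define w where "w t = cone_weight p q r DIM('a) t * indicator {0<..<1} t" for t
  define C where "C = Cconst p q r DIM('a)"
  define A where "A = V powr (p + 1 - p / q) * N powr (p / q)"
  define k where "k t = (t ^ r / cone_weight p q r DIM('a) t) * indicator {0<..<1} t" for t
  have [measurable]: "(\<lambda>(t, x). g t x) \<in> borel_measurable (lborel \<Otimes>\<^sub>M lborel)"
    "(\<lambda>(x, t). g t x) \<in> borel_measurable (lborel \<Otimes>\<^sub>M lborel)"
    unfolding g_def by measurable
  have [measurable]: "(\<lambda>t. g t x) \<in> borel_measurable lborel" "(\<lambda>x. g t x) \<in> borel_measurable lborel" for x t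
    unfolding g_def by measurable
  have [measurable]: "w \<in> borel_measurable lborel" "k \<in> borel_measurable lborel"
    unfolding w_def k_def by measurable
  have wint: "(\<integral>\<^sup>+t. ennreal (w t) \<partial>lborel) = ennreal C" and C: "C > 0"
    unfolding w_def C_def using cone_weight_integral[of q p "DIM('a)" r] pq by auto
  have p: "p \<ge> 1" "p > 0" "q > 0" using pq by auto
  have w0: "w t \<ge> 0" and k0: "t \<in> {0<..<1} \<Longrightarrow> k t > 0" for t
    using cone_weight_pos[of t p q r "DIM('a)"] by (auto simp: w_def k_def indicator_def)
  have A0: "A \<ge> 0" by (simp add: A_def)
  have kw: "ennreal (k t) * ennreal (w t) = ennreal (t ^ r) * indicator {0<..<1} t" for t
    using cone_weight_pos[of t p q r "DIM('a)"]
    by (auto simp: w_def k_def indicator_def ennreal_mult[symmetric])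
  have slice: "(\<integral>\<^sup>+x. epowr (g t x * ennreal (k t)) p * ennreal (w t) * indicator S x \<partial>lborel) \<le> ennreal A * ennreal (w t)" for t
  proof (cases "t \<in> {0<..<1}")
    case True
    then have t: "0 < t" "t < 1" by auto
    define W where "W = cone_weight p q r DIM('a) t"
    have W: "W > 0" unfolding W_def by (rule cone_weight_pos[OF t])
    obtain \<mu> where \<mu>: "\<mu> = t powr - real DIM('a) \<or> \<mu> = (1 - t) powr - real DIM('a)"
      "(1 - t) powr (- real DIM('a) * (p / q - 1)) * \<mu> = (W / t ^ r) powr p"
      using cone_weight_powr[OF t p(2,3)] unfolding W_def by metis
    have kt: "k t = t ^ r / W" "w t = W" using True by (auto simp: k_def w_def W_def)
    have "(\<integral>\<^sup>+x. epowr (g t x * ennreal (k t)) p * ennreal (w t) * indicator S x \<partial>lborel)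
        = (\<integral>\<^sup>+x. ennreal (k t powr p * w t) * (epowr (g t x) p * indicator S x) \<partial>lborel)"
      using p k0[OF True] w0 by (intro nn_integral_cong) (simp add: epowr_mult ennreal_mult mult_ac)
    also have "\<dots> = ennreal (k t powr p * w t) * (\<integral>\<^sup>+x. epowr (g t x) p * indicator S x \<partial>lborel)"
      by (rule nn_integral_cmult) measurable
    also have "\<dots> \<le> ennreal (k t powr p * w t) * ennreal (A * ((1 - t) powr (- real DIM('a) * (p / q - 1)) * \<mu>))"
      using slice_estimate[OF F F0 S V N pq(1,2) t \<mu>(1)]
      by (intro mult_left_mono) (simp_all add: g_def A_def mult.assoc)
    also have "\<dots> = ennreal ((k t powr p * w t) * (A * (W / t ^ r) powr p))"
      unfolding \<mu>(2) using w0 A0 by (intro ennreal_mult[symmetric]) auto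
    also have "(k t powr p * w t) * (A * (W / t ^ r) powr p) = A * w t"
      using t W by (simp add: kt powr_divide)
    finally show ?thesis using A0 w0 by (simp add: ennreal_mult)
  qed (simp add: w_def)
  have jensen: "epowr (\<integral>\<^sup>+t. g t x * (ennreal (t ^ r) * indicator {0<..<1} t) \<partial>lborel) p
      \<le> ennreal (C powr (p - 1)) * (\<integral>\<^sup>+t. epowr (g t x * ennreal (k t)) p * ennreal (w t) \<partial>lborel)" for x
    using epowr_nn_integral_le[of "\<lambda>t. g t x * ennreal (k t)" lborel w C p] wint C p
    by (simp add: mult.assoc kw)
  have "(\<integral>\<^sup>+x. epowr (\<integral>\<^sup>+t. g t x * (ennreal (t ^ r) * indicator {0<..<1} t) \<partial>lborel) p * indicator S x \<partial>lborel)
      \<le> (\<integral>\<^sup>+x. ennreal (C powr (p - 1)) * (\<integral>\<^sup>+t. epowr (g t x * ennreal (k t)) p * ennreal (w t) * indicator S x \<partial>lborel) \<partial>lborel)"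
  proof (rule nn_integral_mono)
    fix x
    show "epowr (\<integral>\<^sup>+t. g t x * (ennreal (t ^ r) * indicator {0<..<1} t) \<partial>lborel) p * indicator S x
      \<le> ennreal (C powr (p - 1)) * (\<integral>\<^sup>+t. epowr (g t x * ennreal (k t)) p * ennreal (w t) * indicator S x \<partial>lborel)"
      using jensen[of x] by (cases "x \<in> S") auto
  qed
  also have "\<dots> = ennreal (C powr (p - 1)) *
      (\<integral>\<^sup>+x. (\<integral>\<^sup>+t. epowr (g t x * ennreal (k t)) p * ennreal (w t) * indicator S x \<partial>lborel) \<partial>lborel)"
    by (rule nn_integral_cmult) measurable
  also have "(\<integral>\<^sup>+x. (\<integral>\<^sup>+t. epowr (g t x * ennreal (k t)) p * ennreal (w t) * indicator S x \<partial>lborel) \<partial>lborel)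
      = (\<integral>\<^sup>+t. (\<integral>\<^sup>+x. epowr (g t x * ennreal (k t)) p * ennreal (w t) * indicator S x \<partial>lborel) \<partial>lborel)"
    by (rule lborel_pair.Fubini') measurable
  also have "ennreal (C powr (p - 1)) * \<dots> \<le> ennreal (C powr (p - 1)) * (\<integral>\<^sup>+t. ennreal A * ennreal (w t) \<partial>lborel)"
    by (intro mult_left_mono nn_integral_mono slice) auto
  also have "\<dots> = ennreal (C powr (p - 1) * (A * C))"
    using wint A0 C by (simp add: nn_integral_cmult ennreal_mult)
  also have "C powr (p - 1) * (A * C) = C powr p * A"
    using C by (simp add: powr_diff)
  finally show ?thesis by (simp add: g_def C_def A_def)
qed

subsection \<open>Choice of the averaging set\<close>

lemma exists_compact_measure_gt:
  fixes S :: "'a::euclidean_space set"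
  assumes "open S" "bounded S" "\<theta> < measure lborel S"
  obtains K where "compact K" "K \<subseteq> S" "measure lborel K > \<theta>"
proof -
  have S: "S \<in> sets lebesgue" using assms by auto
  obtain T where T: "closed T" "T \<subseteq> S" "S - T \<in> lmeasurable"
    "emeasure lebesgue (S - T) < ennreal (measure lborel S - \<theta>)"
    using sets_lebesgue_inner_closed[OF S, of "measure lborel S - \<theta>"] assms(3) by auto
  have cT: "compact T" using T assms bounded_subset compact_eq_bounded_closed by blast
  have fin: "emeasure lborel S < \<infinity>" "emeasure lborel T < \<infinity>"
    using assms(2) emeasure_bounded_finite emeasure_compact_finite cT by auto
  have "emeasure lebesgue (S - T) = emeasure lborel (S - T)"
    using assms(1) T(1) by (simp add: open_Diff)
  then have "emeasure lborel (S - T) < ennreal (measure lborel S - \<theta>)" using T(4) by simp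
  moreover have "emeasure lborel (S - T) = ennreal (measure lborel (S - T))"
    using fin emeasure_mono[of "S - T" S lborel] assms(1)
    by (intro emeasure_eq_ennreal_measure) (auto simp: top_unique)
  ultimately have "measure lborel (S - T) < measure lborel S - \<theta>"
    using ennreal_less_iff by auto
  moreover have "measure lborel (S - T) = measure lborel S - measure lborel T"
    using T assms(1) fin by (intro measure_Diff) auto
  ultimately show ?thesis using that[OF cT T(2)] by simp
qed

text \<open>The inner integral on the left runs over y in all of \<open>S\<close>, so it dominates
  the one over \<open>K\<close>, while the right side carries the measure of \<open>K\<close>.
  Dividing by that measure thus bounds the average over \<open>K\<close> by the constant for
  \<open>S\<close>.\<close>

lemma exists_compact_averaging_set:
  fixes F :: "'a::euclidean_space \<Rightarrow> real" and S :: "'a set"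
  assumes F [measurable]: "F \<in> borel_measurable borel" and F0: "\<And>x. F x \<ge> 0"
    and S: "open S" "bounded S" and V: "measure lborel S = V" "V > 0"
    and N: "(\<integral>\<^sup>+z. ennreal (F z powr q) \<partial>lborel) = ennreal N" "N \<ge> 0"
    and pq: "q \<ge> 1" "p \<ge> q" "1 / q - 1 / p < 1 / real DIM('a)"
  obtains K where "compact K" "K \<subseteq> S" "measure lborel K > 0"
    "(\<integral>\<^sup>+x. epowr (\<integral>\<^sup>+t. (\<integral>\<^sup>+y. ennreal (norm (x - y) * F (cone_point x (y, t))) * indicator S y \<partial>lborel)
        * (ennreal (t ^ r) * indicator {0<..<1} t) \<partial>lborel) p * indicator S x \<partial>lborel)
    \<le> ennreal ((measure lborel K * (V powr (1 / p - 1 / q) * Cconst p q r DIM('a) * diameter S * N powr (1 / q))) powr p)"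
proof -
  define R where "R = diameter S"
  define C where "C = Cconst p q r DIM('a)"
  define A where "A x = (\<integral>\<^sup>+t. (\<integral>\<^sup>+y. ennreal (F (cone_point x (y, t))) * indicator S y \<partial>lborel)
        * (ennreal (t ^ r) * indicator {0<..<1} t) \<partial>lborel)" for x
  define a where "a x = (\<integral>\<^sup>+t. (\<integral>\<^sup>+y. ennreal (norm (x - y) * F (cone_point x (y, t))) * indicator S y \<partial>lborel)
        * (ennreal (t ^ r) * indicator {0<..<1} t) \<partial>lborel)" for x
  define B where "B = V * (V powr (1 / p - 1 / q) * C * R * N powr (1 / q))"
  have [measurable]: "S \<in> sets borel" using S by auto
  have [measurable]: "A \<in> borel_measurable lborel" "a \<in> borel_measurable lborel"
    unfolding A_def a_def by measurable
  have p: "p > 0" "p \<ge> 1" "q > 0" using pq by auto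
  have Vem: "emeasure lborel S = ennreal V"
    using V emeasure_eq_ennreal_measure[of lborel S] emeasure_bounded_finite[OF S(2)] by auto
  have C: "C > 0" unfolding C_def using cone_weight_integral(2)[of q p "DIM('a)" r] pq by auto
  have R: "R \<ge> 0" unfolding R_def using S diameter_ge_0 by blast
  have B0: "B \<ge> 0" unfolding B_def using V C R by simp
  have Bp: "B powr p = R powr p * (C powr p * (V powr (p + 1 - p / q) * N powr (p / q)))"
  proof -
    have "B powr p = V powr p * ((V powr (1 / p - 1 / q)) powr p * C powr p * R powr p * (N powr (1 / q)) powr p)"
      unfolding B_def using V C R by (simp add: powr_mult)
    also have "(V powr (1 / p - 1 / q)) powr p = V powr (1 - p / q)"
      using p by (simp add: powr_powr left_diff_distrib)
    also have "(N powr (1 / q)) powr p = N powr (p / q)"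
      by (simp add: powr_powr)
    also have "V powr p * (V powr (1 - p / q) * C powr p * R powr p * N powr (p / q))
        = (V powr p * V powr (1 - p / q)) * C powr p * R powr p * N powr (p / q)" by simp
    also have "V powr p * V powr (1 - p / q) = V powr (p + 1 - p / q)"
      by (simp add: powr_add[symmetric] add_diff_eq)
    finally show ?thesis by (simp add: mult_ac)
  qed
  \<comment> \<open>A ball of radius e around x lies in \<open>S\<close>; moving x away from y by e
    stays in \<open>S\<close> and lengthens the distance by e, so |x - y| + e \<le> R.\<close>
  have radius: "\<exists>\<rho>. 0 \<le> \<rho> \<and> \<rho> < R \<and> (\<forall>y\<in>S. norm (x - y) \<le> \<rho>)" if x: "x \<in> S" for x
  proof -
    obtain e where e: "e > 0" "cball x e \<subseteq> S" using S(1) x open_contains_cball by blast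
    have "norm (x - y) \<le> R - e" if y: "y \<in> S" for y
    proof (cases "x = y")
      case True
      obtain b :: 'a where b: "b \<in> Basis" using nonempty_Basis by blast
      have "x + e *\<^sub>R b \<in> S" using e b by (auto simp: dist_norm subset_eq)
      from diameter_bounded_bound[OF S(2) this x] have "norm (x + e *\<^sub>R b - x) \<le> R"
        by (simp only: R_def dist_norm)
      then show ?thesis using True e b by simp
    next
      case False
      define u where "u = (x - y) /\<^sub>R norm (x - y)"
      have u: "norm u = 1" using False by (simp add: u_def)
      have "x + e *\<^sub>R u \<in> S" using e u by (auto simp: dist_norm subset_eq)
      from diameter_bounded_bound[OF S(2) this y] have "norm (x + e *\<^sub>R u - y) \<le> R"
        by (simp only: R_def dist_norm)
      moreover have "x + e *\<^sub>R u - y = (norm (x - y) + e) *\<^sub>R u"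
        using False by (simp add: u_def algebra_simps)
      ultimately show ?thesis using u e by simp
    qed
    moreover from this[OF x] have "0 \<le> R - e" by simp
    ultimately show ?thesis using e by (intro exI[of _ "R - e"]) auto
  qed
  have aA: "a x \<le> ennreal \<rho> * A x" if "\<rho> \<ge> 0" "\<forall>y\<in>S. norm (x - y) \<le> \<rho>" for x \<rho>
  proof -
    have "a x \<le> (\<integral>\<^sup>+t. ennreal \<rho> * ((\<integral>\<^sup>+y. ennreal (F (cone_point x (y, t))) * indicator S y \<partial>lborel)
        * (ennreal (t ^ r) * indicator {0<..<1} t)) \<partial>lborel)"
      unfolding a_def mult.assoc[symmetric]
    proof (intro nn_integral_mono mult_right_mono)
      fix t
      have "(\<integral>\<^sup>+y. ennreal (norm (x - y) * F (cone_point x (y, t))) * indicator S y \<partial>lborel)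
         \<le> (\<integral>\<^sup>+y. ennreal \<rho> * (ennreal (F (cone_point x (y, t))) * indicator S y) \<partial>lborel)"
        using that F0 by (intro nn_integral_mono)
          (auto simp: indicator_def ennreal_mult[symmetric] intro!: ennreal_leI mult_right_mono)
      also have "\<dots> = ennreal \<rho> * (\<integral>\<^sup>+y. ennreal (F (cone_point x (y, t))) * indicator S y \<partial>lborel)"
        by (rule nn_integral_cmult) measurable
      finally show "(\<integral>\<^sup>+y. ennreal (norm (x - y) * F (cone_point x (y, t))) * indicator S y \<partial>lborel)
         \<le> ennreal \<rho> * (\<integral>\<^sup>+y. ennreal (F (cone_point x (y, t))) * indicator S y \<partial>lborel)" .
    qed auto
    also have "\<dots> = ennreal \<rho> * A x"
      unfolding A_def by (rule nn_integral_cmult) measurable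
    finally show ?thesis .
  qed
  define f where "f x = epowr (a x) p * indicator S x" for x
  define g where "g x = epowr (ennreal R * A x) p * indicator S x" for x
  have [measurable]: "f \<in> borel_measurable lborel" "g \<in> borel_measurable lborel"
    unfolding f_def g_def by measurable
  have fg: "f x \<le> g x" for x
  proof (cases "x \<in> S")
    case True
    then obtain \<rho> where \<rho>: "0 \<le> \<rho>" "\<rho> < R" "\<forall>y\<in>S. norm (x - y) \<le> \<rho>" using radius by blast
    have "a x \<le> ennreal \<rho> * A x" using aA \<rho> by blast
    also have "\<dots> \<le> ennreal R * A x" using \<rho> by (intro mult_right_mono) auto
    finally show ?thesis using p by (auto simp: f_def g_def intro!: mult_right_mono epowr_mono)
  qed (simp add: f_def g_def)
  have gB: "(\<integral>\<^sup>+x. g x \<partial>lborel) \<le> ennreal (B powr p)"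
  proof -
    have "(\<integral>\<^sup>+x. g x \<partial>lborel) = (\<integral>\<^sup>+x. ennreal (R powr p) * (epowr (A x) p * indicator S x) \<partial>lborel)"
      using p R by (simp add: g_def epowr_mult mult.assoc)
    also have "\<dots> = ennreal (R powr p) * (\<integral>\<^sup>+x. epowr (A x) p * indicator S x \<partial>lborel)"
      by (rule nn_integral_cmult) measurable
    also have "\<dots> \<le> ennreal (R powr p) * ennreal (C powr p * (V powr (p + 1 - p / q) * N powr (p / q)))"
      using averaged_estimate[OF F F0 _ Vem V(2) N pq, of r] unfolding A_def C_def
      by (intro mult_left_mono) auto
    finally show ?thesis unfolding Bp by (simp add: ennreal_mult)
  qed
  have ffin: "(\<integral>\<^sup>+x. f x \<partial>lborel) \<le> ennreal (B powr p)"
    using nn_integral_mono[of lborel f g] fg gB order_trans by blast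
  obtain X where X: "X \<ge> 0" "(\<integral>\<^sup>+x. f x \<partial>lborel) = ennreal X"
    using ffin by (cases "(\<integral>\<^sup>+x. f x \<partial>lborel)") (auto simp: top_unique)
  \<comment> \<open>Here f \<le> g, and g has finite integral. Equality of the integrals would force
    g \<le> f almost everywhere; on \<open>S\<close> this bounds (R A(x))^p by (\<rho> A(x))^p with
    \<rho> < R, hence A(x) = 0 and f(x) = 0.\<close>
  have strict: "X = 0 \<or> X < B powr p"
  proof (cases "AE x in lborel. g x \<le> f x")
    case False
    have "(\<integral>\<^sup>+x. f x \<partial>lborel) < (\<integral>\<^sup>+x. g x \<partial>lborel)"
      using fg False X by (intro nn_integral_less) auto
    then have "ennreal X < ennreal (B powr p)" using gB X by simp
    then show ?thesis using X by (simp add: ennreal_less_iff)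
  next
    case True
    have "(\<integral>\<^sup>+x. g x \<partial>lborel) \<noteq> \<infinity>" using gB by (auto simp: top_unique)
    then have "AE x in lborel. g x \<noteq> \<infinity>" by (intro nn_integral_PInf_AE) auto
    then have "AE x in lborel. f x = 0"
      using True
    proof eventually_elim
      case (elim x)
      show ?case
      proof (cases "x \<in> S")
        case True
        then obtain \<rho> where \<rho>: "0 \<le> \<rho>" "\<rho> < R" "\<forall>y\<in>S. norm (x - y) \<le> \<rho>" using radius by blast
        have le: "epowr (ennreal R * A x) p \<le> epowr (ennreal \<rho> * A x) p"
          using elim(2) True epowr_mono[OF p(1) aA[OF \<rho>(1,3)]] by (simp add: f_def g_def)
        have "A x \<noteq> top"
          using elim(1) True \<rho> by (auto simp: g_def ennreal_mult_top)
        then obtain s where s: "s \<ge> 0" "A x = ennreal s" by (cases "A x") auto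
        have "(R * s) powr p \<le> (\<rho> * s) powr p"
          using le s R \<rho> by (simp add: ennreal_mult[symmetric])
        then have "s = 0"
          using s \<rho> p powr_less_mono2[of p "\<rho> * s" "R * s"] by (cases "s = 0") auto
        then have "a x = 0" using aA[OF \<rho>(1,3)] s by simp
        then show ?thesis by (simp add: f_def)
      qed (simp add: f_def)
    qed
    then have "(\<integral>\<^sup>+x. f x \<partial>lborel) = 0" by (subst nn_integral_0_iff_AE) auto
    then show ?thesis using X by simp
  qed
  \<comment> \<open>The threshold at which (|K| / V) B reaches X^(1/p). If X = 0, any
    \<open>K\<close> of positive measure will do.\<close>
  define \<theta> where "\<theta> = (if X = 0 then 0 else V * (X powr (1 / p) / B))"
  have Xroot: "X powr (1 / p) < B" if "X \<noteq> 0"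
  proof -
    have "X powr (1 / p) < (B powr p) powr (1 / p)"
      using strict that X p by (intro powr_less_mono2) auto
    then show ?thesis using B0 p by (simp add: powr_powr)
  qed
  have \<theta>: "0 \<le> \<theta>" "\<theta> < V"
  proof -
    show "0 \<le> \<theta>" using V B0 by (simp add: \<theta>_def)
    have "X powr (1 / p) / B < 1" if "X \<noteq> 0"
      using Xroot[OF that] powr_ge_zero[of X "1 / p"] B0 by (auto simp: divide_less_eq_1)
    then show "\<theta> < V"
      using V mult_strict_left_mono[of "X powr (1 / p) / B" 1 V] by (simp add: \<theta>_def)
  qed
  obtain K where K: "compact K" "K \<subseteq> S" "measure lborel K > \<theta>"
    using exists_compact_measure_gt[OF S] V \<theta> by metis
  have "X \<le> (measure lborel K / V * B) powr p"
  proof (cases "X = 0")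
    case False
    have "B > 0" using Xroot[OF False] powr_ge_zero[of X "1 / p"] by linarith
    have "X powr (1 / p) = \<theta> / V * B" using False V \<open>B > 0\<close> by (simp add: \<theta>_def)
    also have "\<dots> \<le> measure lborel K / V * B"
      using K V \<open>B > 0\<close> by (intro mult_right_mono divide_right_mono) auto
    finally have "(X powr (1 / p)) powr p \<le> (measure lborel K / V * B) powr p"
      using p by (intro powr_mono2) auto
    then show ?thesis using X p by (simp add: powr_powr)
  qed simp
  moreover have "measure lborel K / V * B = measure lborel K * (V powr (1 / p - 1 / q) * C * R * N powr (1 / q))"
    using V by (simp add: B_def)
  ultimately have "(\<integral>\<^sup>+x. f x \<partial>lborel)
      \<le> ennreal ((measure lborel K * (V powr (1 / p - 1 / q) * C * R * N powr (1 / q))) powr p)"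
    using X by (simp add: ennreal_leI)
  then show ?thesis
    using that[OF K(1,2)] K(3) \<theta> by (simp add: f_def a_def C_def R_def)
qed

subsection \<open>The estimate for the averaged primitive\<close>

text \<open>Minkowski's integral inequality for finitely many components: pair the vector
  \<open>A\<close> of integrals with the integrand, apply Cauchy-Schwarz under the integral, and
  divide by the length of \<open>A\<close>.\<close>

lemma L2_set_integral_le:
  fixes f :: "'i \<Rightarrow> 'b::euclidean_space \<Rightarrow> real"
  assumes W: "compact W" and f: "\<And>i. i \<in> I \<Longrightarrow> continuous_on W (f i)"
  shows "L2_set (\<lambda>i. LINT w:W|lborel. f i w) I \<le> (LINT w:W|lborel. L2_set (\<lambda>i. f i w) I)"
proof -
  define A where "A i = (LINT w:W|lborel. f i w)" for i
  have cL: "continuous_on W (\<lambda>w. L2_set (\<lambda>i. f i w) I)"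
    unfolding L2_set_def by (intro continuous_intros f)
  have pos: "(LINT w:W|lborel. L2_set (\<lambda>i. f i w) I) \<ge> 0"
    unfolding set_lebesgue_integral_def
    by (intro Bochner_Integration.integral_nonneg) (auto simp: L2_set_nonneg)
  have "(L2_set A I)\<^sup>2 = (\<Sum>i\<in>I. A i * (LINT w:W|lborel. f i w))"
    unfolding L2_set_def A_def by (simp add: sum_nonneg power2_eq_square)
  also have "\<dots> = (LINT w:W|lborel. \<Sum>i\<in>I. A i * f i w)"
    by (subst set_integral_sum_compact[OF W]) (auto intro!: continuous_intros f)
  also have "\<dots> \<le> (LINT w:W|lborel. L2_set A I * L2_set (\<lambda>i. f i w) I)"
  proof (intro set_integral_mono set_integrable_compact W continuous_intros f cL)
    fix w
    have "(\<Sum>i\<in>I. A i * f i w) \<le> (\<Sum>i\<in>I. \<bar>A i\<bar> * \<bar>f i w\<bar>)"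
      by (intro sum_mono) (metis abs_ge_self abs_mult)
    then show "(\<Sum>i\<in>I. A i * f i w) \<le> L2_set A I * L2_set (\<lambda>i. f i w) I"
      by (rule order_trans[OF _ L2_set_mult_ineq])
  qed
  finally have le: "L2_set A I * L2_set A I \<le> L2_set A I * (LINT w:W|lborel. L2_set (\<lambda>i. f i w) I)"
    unfolding power2_eq_square set_integral_mult_right .
  have "L2_set A I \<le> (LINT w:W|lborel. L2_set (\<lambda>i. f i w) I)"
  proof (cases "L2_set A I = 0")
    case False
    then have "L2_set A I > 0" using L2_set_nonneg[of A I] by linarith
    from mult_left_le_imp_le[OF le this] show ?thesis .
  qed (use pos in simp)
  then show ?thesis unfolding A_def .
qed

lemma covector_norm_eq_L2_set: "covector_norm r \<alpha> = L2_set \<alpha> (basis_tuples r) / sqrt (fact r)"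
  by (simp add: covector_norm_def L2_set_def real_sqrt_divide)

lemma covector_norm_nonneg: "covector_norm r \<alpha> \<ge> 0"
  by (simp add: covector_norm_eq_L2_set L2_set_nonneg)

lemma covector_norm_scale: "c \<ge> 0 \<Longrightarrow> covector_norm r (\<lambda>vs. c * \<alpha> vs) = c * covector_norm r \<alpha>"
  by (simp add: covector_norm_eq_L2_set L2_set_right_distrib)

lemma continuous_on_covector_norm:
  "(\<And>ws. continuous_on S (\<lambda>z. \<alpha> z ws)) \<Longrightarrow> continuous_on S (\<lambda>z. covector_norm r (\<alpha> z))"
  unfolding covector_norm_def by (intro continuous_intros) auto

context averaged_homotopy
begin

text \<open>Minkowski moves the norm under the integral, where contraction with x - y costs at most
  |x - y|.\<close>

lemma covector_norm_primitive:
  assumes x: "x \<in> V"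
  shows "covector_norm r (primitive x)
    \<le> (LINT w:W|lborel. snd w ^ r * (norm (x - fst w) * covector_norm (Suc r) (\<alpha> (cone_point x w)))) / measure lborel K"
proof -
  define f where "f es w = snd w ^ r * \<alpha> (cone_point x w) ((x - fst w) # es)" for es w
  have cf: "continuous_on W (f es)" for es
    by (subst continuous_on_cong[OF refl, where g = "integrand es x"])
      (auto simp: f_def integrand_eq[OF x] intro: continuous_on_param_section[OF continuous_integrand x])
  have cn: "continuous_on W (\<lambda>w. covector_norm (Suc r) (\<alpha> (cone_point x w)))"
    by (intro continuous_on_covector_norm
        continuous_on_param_section[where G = "\<lambda>x w. \<alpha> (cone_point x w) ws" for ws, OF _ x])
      (use continuous_form in \<open>simp add: split_beta\<close>)
  have cL: "continuous_on W (\<lambda>w. covector_norm r (\<lambda>es. f es w))"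
    by (intro continuous_on_covector_norm cf)
  have "covector_norm r (primitive x)
      = L2_set (\<lambda>es. LINT w:W|lborel. f es w) (basis_tuples r) / sqrt (fact r) / measure lborel K"
    using covector_norm_scale[of "inverse (measure lborel K)" r "\<lambda>es. LINT w:W|lborel. f es w"]
    by (simp add: primitive_def[abs_def] f_def covector_norm_eq_L2_set divide_inverse mult_ac)
  also have "\<dots> \<le> (LINT w:W|lborel. L2_set (\<lambda>es. f es w) (basis_tuples r)) / sqrt (fact r) / measure lborel K"
    by (intro divide_right_mono L2_set_integral_le compact_W cf) auto
  also have "\<dots> = (LINT w:W|lborel. covector_norm r (\<lambda>es. f es w)) / measure lborel K"
    by (simp add: covector_norm_eq_L2_set)
  also have "\<dots> \<le> (LINT w:W|lborel. snd w ^ r * (norm (x - fst w) * covector_norm (Suc r) (\<alpha> (cone_point x w)))) / measure lborel K"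
  proof (intro divide_right_mono set_integral_mono set_integrable_compact compact_W cL continuous_intros cn)
    fix w assume w: "w \<in> W"
    then have t: "snd w ^ r \<ge> 0" by (auto simp: W_def)
    have "covector_norm r (\<lambda>es. f es w) = snd w ^ r * covector_norm r (\<lambda>es. \<alpha> (cone_point x w) ((x - fst w) # es))"
      unfolding f_def by (rule covector_norm_scale[OF t])
    also have "\<dots> \<le> snd w ^ r * (norm (x - fst w) * covector_norm (Suc r) (\<alpha> (cone_point x w)))"
      by (intro mult_left_mono covector_norm_contract covector_form cone_point_in x w t)
    finally show "covector_norm r (\<lambda>es. f es w)
        \<le> snd w ^ r * (norm (x - fst w) * covector_norm (Suc r) (\<alpha> (cone_point x w)))" .
  qed auto
  finally show ?thesis .
qed

text \<open>Links the Bochner integral over pairs (y, t) to the iterated integral of the averaging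
  estimate. \<open>F\<close> will be |d\<omega>| cut off outside the interior, which agrees with
  |d\<omega>| at all cone points of an interior x.\<close>

lemma covector_norm_primitive_nn_integral:
  assumes x: "x \<in> V" and S: "K \<subseteq> S"
    and F: "\<And>w. w \<in> W \<Longrightarrow> F (cone_point x w) = covector_norm (Suc r) (\<alpha> (cone_point x w))"
  shows "ennreal (covector_norm r (primitive x)) \<le> ennreal (1 / measure lborel K) *
    (\<integral>\<^sup>+t. (\<integral>\<^sup>+y. ennreal (norm (x - y) * F (cone_point x (y, t))) * indicator S y \<partial>lborel)
        * (ennreal (t ^ r) * indicator {0<..<1} t) \<partial>lborel)"
proof -
  define h where "h w = snd w ^ r * (norm (x - fst w) * covector_norm (Suc r) (\<alpha> (cone_point x w)))" for w
  have cn: "continuous_on W (\<lambda>w. covector_norm (Suc r) (\<alpha> (cone_point x w)))"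
    by (intro continuous_on_covector_norm
        continuous_on_param_section[where G = "\<lambda>x w. \<alpha> (cone_point x w) ws" for ws, OF _ x])
      (use continuous_form in \<open>simp add: split_beta\<close>)
  have ch: "continuous_on W h" unfolding h_def by (intro continuous_intros cn)
  have int: "integrable lborel (\<lambda>w. indicator W w *\<^sub>R h w)"
    by (rule borel_integrable_compact[OF compact_W ch])
  then have meas: "(\<lambda>w. ennreal (indicator W w *\<^sub>R h w)) \<in> borel_measurable (lborel \<Otimes>\<^sub>M lborel)"
    unfolding lborel_prod by measurable
  have h0: "indicator W w *\<^sub>R h w \<ge> 0" for w
    by (auto simp: indicator_def h_def W_def covector_norm_nonneg)
  have "ennreal (LINT w:W|lborel. h w) = (\<integral>\<^sup>+w. ennreal (indicator W w *\<^sub>R h w) \<partial>lborel)"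
    unfolding set_lebesgue_integral_def using int h0 by (intro nn_integral_eq_integral[symmetric]) auto
  also have "\<dots> = (\<integral>\<^sup>+t. (\<integral>\<^sup>+y. ennreal (indicator W (y, t) *\<^sub>R h (y, t)) \<partial>lborel) \<partial>lborel)"
    using lborel_pair.nn_integral_snd[OF meas] by (simp add: lborel_prod)
  also have "\<dots> \<le> (\<integral>\<^sup>+t. (\<integral>\<^sup>+y. ennreal (norm (x - y) * F (cone_point x (y, t))) * indicator S y \<partial>lborel)
        * (ennreal (t ^ r) * indicator {0<..<1} t) \<partial>lborel)"
  proof (rule nn_integral_mono_AE)
    have "AE t in lborel. t \<noteq> (0::real)" "AE t in lborel. t \<noteq> (1::real)"
      by (rule AE_lborel_singleton)+
    then show "AE t in lborel. (\<integral>\<^sup>+y. ennreal (indicator W (y, t) *\<^sub>R h (y, t)) \<partial>lborel)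
      \<le> (\<integral>\<^sup>+y. ennreal (norm (x - y) * F (cone_point x (y, t))) * indicator S y \<partial>lborel)
        * (ennreal (t ^ r) * indicator {0<..<1} t)"
    proof eventually_elim
      case (elim t)
      show ?case
      proof (cases "t \<in> {0<..<1}")
        case True
        have meas_y: "(\<lambda>y. ennreal (indicator W (y, t) *\<^sub>R h (y, t))) \<in> borel_measurable lborel"
          using measurable_Pair1[OF meas] by simp
        \<comment> \<open>The factor t^r has to leave the y-integral, which requires a measurable
          integrand. As \<open>F\<close> is known at cone points only, measurability of
          \<open>k\<close> is read off from the section of \<open>h\<close>, divided by t^r >
          0.\<close>
        define k where "k y = ennreal (indicator W (y, t) *\<^sub>R (norm (x - y) * F (cone_point x (y, t))))" for y
        have k: "k y * ennreal (t ^ r) = ennreal (indicator W (y, t) *\<^sub>R h (y, t))" for y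
          using True F[of "(y, t)"]
          by (cases "(y, t) \<in> W") (auto simp: k_def h_def ennreal_mult covector_norm_nonneg mult_ac)
        have "k \<in> borel_measurable lborel"
        proof -
          have "k = (\<lambda>y. ennreal (indicator W (y, t) *\<^sub>R h (y, t)) * ennreal (1 / t ^ r))"
          proof
            fix y
            show "k y = ennreal (indicator W (y, t) *\<^sub>R h (y, t)) * ennreal (1 / t ^ r)"
              unfolding k[symmetric] using True by (simp add: mult.assoc ennreal_mult[symmetric])
          qed
          then show ?thesis using meas_y by simp
        qed
        then have "(\<integral>\<^sup>+y. ennreal (indicator W (y, t) *\<^sub>R h (y, t)) \<partial>lborel) = (\<integral>\<^sup>+y. k y \<partial>lborel) * ennreal (t ^ r)"
          unfolding k[symmetric] by (rule nn_integral_multc)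
        also have "\<dots> \<le> (\<integral>\<^sup>+y. ennreal (norm (x - y) * F (cone_point x (y, t))) * indicator S y \<partial>lborel) * ennreal (t ^ r)"
          using S by (intro mult_right_mono nn_integral_mono) (auto simp: k_def indicator_def W_def)
        finally show ?thesis using True by simp
      next
        case False
        then have "t \<notin> {0..1}" using elim by auto
        then show ?thesis by (simp add: W_def)
      qed
    qed
  qed
  finally have le: "ennreal (LINT w:W|lborel. h w) \<le> (\<integral>\<^sup>+t. (\<integral>\<^sup>+y. ennreal (norm (x - y) * F (cone_point x (y, t))) * indicator S y \<partial>lborel)
        * (ennreal (t ^ r) * indicator {0<..<1} t) \<partial>lborel)" .
  have "ennreal (covector_norm r (primitive x)) \<le> ennreal ((1 / measure lborel K) * (LINT w:W|lborel. h w))"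
    using covector_norm_primitive[OF x] by (intro ennreal_leI) (simp add: h_def)
  also have "\<dots> = ennreal (1 / measure lborel K) * ennreal (LINT w:W|lborel. h w)"
    by (rule ennreal_mult') simp
  finally show ?thesis using le by (meson mult_left_mono order_trans zero_le)
qed

end

section \<open>From the interior to the convex set, and the cases of the theorem\<close>

lemma Lp_norm_eq_epowr:
  "Lp_norm p r D \<alpha> = epowr (\<integral>\<^sup>+x\<in>D. ennreal (covector_norm r (\<alpha> x) powr p) \<partial>lebesgue) (1 / p)"
  by (simp add: Lp_norm_def epowr_def Let_def)

text \<open>The frontier of a convex set is a null set, so the Lebesgue integral over a possibly
  non-Borel \<open>D\<close> becomes a Borel integral over an open set.\<close>

lemma nn_integral_convex_interior:
  fixes D :: "'a::euclidean_space set"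
  assumes "convex D"
  shows "(\<integral>\<^sup>+x\<in>D. f x \<partial>lebesgue) = (\<integral>\<^sup>+x\<in>interior D. f x \<partial>lborel)"
proof -
  have "frontier D \<in> null_sets lborel"
    using negligible_convex_frontier[OF assms]
    by (simp add: negligible_iff_null_sets null_sets_completion_iff)
  then have "AE x in lborel. x \<notin> frontier D" by (rule AE_not_in)
  then have "AE x in lborel. f x * indicator D x = f x * indicator (interior D) x"
  proof eventually_elim
    case (elim x)
    then show ?case
      using interior_subset[of D] closure_subset[of D] by (auto simp: frontier_def indicator_def)
  qed
  then show ?thesis
    unfolding nn_integral_completion by (rule nn_integral_cong_AE)
qed

lemma smooth_form_onE:
  assumes "smooth_form_on r D \<omega>"
  obtains U where "open U" "D \<subseteq> U" "\<And>x. x \<in> U \<Longrightarrow> covector r (\<omega> x)"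
    "\<And>vs k. Ck_on k U (\<lambda>x. \<omega> x vs)"
proof -
  obtain U where U: "open U" "D \<subseteq> U" "\<And>x. x \<in> U \<Longrightarrow> covector r (\<omega> x)"
    "\<And>vs k. length vs = r \<Longrightarrow> Ck_on k U (\<lambda>x. \<omega> x vs)"
    using assms unfolding smooth_form_on_def by blast
  have "Ck_on k U (\<lambda>x. \<omega> x vs)" for vs k
  proof (cases "length vs = r")
    case False
    then show ?thesis
      using covector_length[OF U(3)] by (intro Ck_on_cong[OF U(1) _ Ck_on_const[OF U(1), of k 0]]) auto
  qed (rule U(4))
  from that[OF U(1-3) this] show ?thesis .
qed

lemma primitive_estimate:
  fixes D :: "'a::euclidean_space set" and \<omega> :: "'a form"
  assumes pq: "q \<ge> 1" "p \<ge> q" "1 / q - 1 / p < 1 / real DIM('a)"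
    and D: "convex D" "bounded D" "measure lebesgue D > 0"
    and \<omega>: "smooth_form_on r D \<omega>" and fin: "Lp_norm q (Suc r) D (ext_deriv \<omega>) \<noteq> \<infinity>"
  shows "\<exists>\<xi>. smooth_form_on r D \<xi> \<and> (\<forall>x\<in>D. ext_deriv \<omega> x = ext_deriv \<xi> x) \<and>
     Lp_norm p r D \<xi> \<le> ennreal (measure lebesgue D powr (1 / p - 1 / q) * Cconst p q r DIM('a) * diameter D)
                 * Lp_norm q (Suc r) D (ext_deriv \<omega>)"
proof -
  obtain U where U: "open U" "D \<subseteq> U" "\<And>x. x \<in> U \<Longrightarrow> covector r (\<omega> x)" "\<And>vs k. Ck_on k U (\<lambda>x. \<omega> x vs)"
    using smooth_form_onE[OF \<omega>] by metis
  define \<alpha> where "\<alpha> = ext_deriv \<omega>"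
  define S where "S = interior D"
  define vol where "vol = measure lebesgue D"
  have p: "p > 0" "q > 0" using pq by auto
  have SD: "S \<subseteq> D" unfolding S_def by (rule interior_subset)
  have S: "open S" "bounded S" "convex S"
    unfolding S_def using D bounded_interior convex_interior by auto
  have "emeasure lebesgue D = emeasure lborel S"
    using nn_integral_convex_interior[OF D(1), of "\<lambda>_. 1"] S(1) lmeasurable_iff_has_integral measurable_convex[OF D(1,2)]
    by (simp add: S_def fmeasurable_def)
  then have vol: "measure lborel S = vol" "vol > 0" using D(3) by (simp_all add: vol_def measure_def)
  have C\<alpha>: "Ck_on k U (\<lambda>z. \<alpha> z ws)" for k ws
    unfolding \<alpha>_def by (intro Ck_on_ext_deriv U(1,4))
  have cov\<alpha>: "covector (Suc r) (\<alpha> z)" if "z \<in> U" for z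
    unfolding \<alpha>_def using U(4)[of "Suc 0"] that by (intro covector_ext_deriv[OF U(1) that U(3)]) auto
  have closed\<alpha>: "ext_deriv \<alpha> z vs = 0" if "z \<in> U" for z vs
    unfolding \<alpha>_def by (rule ext_deriv_ext_deriv[OF U(1) that U(4)])
  define F where "F z = indicator S z *\<^sub>R covector_norm (Suc r) (\<alpha> z)" for z
  have SU: "S \<subseteq> U" using SD U(2) by blast
  have F_meas: "F \<in> borel_measurable borel"
    unfolding F_def using S(1) Ck_on_continuous[OF C\<alpha>] continuous_on_subset[OF _ SU]
    by (intro borel_measurable_continuous_on_indicator continuous_on_covector_norm) auto
  have F0: "F z \<ge> 0" for z by (simp add: F_def covector_norm_nonneg)
  have Iq: "(\<integral>\<^sup>+x\<in>D. ennreal (covector_norm (Suc r) (\<alpha> x) powr q) \<partial>lebesgue) = (\<integral>\<^sup>+z. ennreal (F z powr q) \<partial>lborel)"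
    unfolding nn_integral_convex_interior[OF D(1)] S_def[symmetric] F_def
    using p by (intro nn_integral_cong) (auto simp: indicator_def)
  obtain N where N: "N \<ge> 0" "(\<integral>\<^sup>+z. ennreal (F z powr q) \<partial>lborel) = ennreal N"
    using fin by (cases "(\<integral>\<^sup>+z. ennreal (F z powr q) \<partial>lborel)")
      (auto simp: Lp_norm_eq_epowr \<alpha>_def[symmetric] Iq)
  have Lq: "Lp_norm q (Suc r) D \<alpha> = ennreal (N powr (1 / q))"
    using N by (simp add: Lp_norm_eq_epowr Iq)
  define a where "a x = (\<integral>\<^sup>+t. (\<integral>\<^sup>+y. ennreal (norm (x - y) * F (cone_point x (y, t))) * indicator S y \<partial>lborel)
        * (ennreal (t ^ r) * indicator {0<..<1} t) \<partial>lborel)" for x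
  define c where "c = vol powr (1 / p - 1 / q) * Cconst p q r DIM('a) * diameter S * N powr (1 / q)"
  obtain K where K: "compact K" "K \<subseteq> S" "measure lborel K > 0"
    "(\<integral>\<^sup>+x. epowr (a x) p * indicator S x \<partial>lborel) \<le> ennreal ((measure lborel K * c) powr p)"
    by (rule exists_compact_averaging_set[OF F_meas F0 S(1,2) vol N(2,1) pq, where r = r])
      (rule that, simp_all only: a_def c_def)
  interpret averaged_homotopy U K r \<alpha>
    by unfold_locales (rule U(1) K(1) K(3) C\<alpha> | erule cov\<alpha> | erule closed\<alpha>)+
  \<comment> \<open>Convexity enters twice: with T = D it puts \<open>D\<close> inside the domain of
    smoothness, and with T = S it keeps the segments from interior points where \<open>F\<close> is
    the norm of d\<omega>.\<close>
  have cone: "cone_point x w \<in> T" if T: "convex T" "x \<in> T" "K \<subseteq> T" "w \<in> W" for x w T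
  proof -
    obtain y t where w: "w = (y, t)" "y \<in> T" "0 \<le> t" "t \<le> 1" using T by (auto simp: W_def)
    then show ?thesis
      using convexD[OF T(1,2) w(2), of t "1 - t"] by (simp add: w(1) cone_point_affine(1))
  qed
  have DV: "D \<subseteq> V" unfolding V_def using cone[OF D(1)] K(2) SD U(2) by blast
  have smooth: "smooth_form_on r D primitive"
    unfolding smooth_form_on_def
    using open_V DV covector_primitive Ck_on_primitive by blast
  have deriv: "\<forall>x\<in>D. ext_deriv \<omega> x = ext_deriv primitive x"
    using ext_deriv_primitive DV by (auto simp: \<alpha>_def)
  have C0: "Cconst p q r DIM('a) > 0"
    using cone_weight_integral(2)[of q p "DIM('a)" r] pq by auto
  have c0: "c \<ge> 0" unfolding c_def using C0 S(2) diameter_ge_0[of S] by simp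
  have bound: "(\<integral>\<^sup>+x\<in>D. ennreal (covector_norm r (primitive x) powr p) \<partial>lebesgue) \<le> ennreal (c powr p)"
  proof -
    have [measurable]: "S \<in> sets borel" using S(1) by auto
    have [measurable]: "a \<in> borel_measurable lborel" unfolding a_def using F_meas by measurable
    have pw: "ennreal (covector_norm r (primitive x)) \<le> ennreal (1 / measure lborel K) * a x" if "x \<in> S" for x
      unfolding a_def
    proof (rule covector_norm_primitive_nn_integral)
      show "x \<in> V" using that SD DV by blast
      show "F (cone_point x w) = covector_norm (Suc r) (\<alpha> (cone_point x w))" if "w \<in> W" for w
        using cone[OF S(3) \<open>x \<in> S\<close> K(2) that] by (simp add: F_def)
    qed (rule K(2))
    have "(\<integral>\<^sup>+x\<in>D. ennreal (covector_norm r (primitive x) powr p) \<partial>lebesgue)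
        = (\<integral>\<^sup>+x\<in>S. epowr (ennreal (covector_norm r (primitive x))) p \<partial>lborel)"
      unfolding nn_integral_convex_interior[OF D(1)] S_def[symmetric] by (simp add: covector_norm_nonneg)
    also have "\<dots> \<le> (\<integral>\<^sup>+x. ennreal ((1 / measure lborel K) powr p) * (epowr (a x) p * indicator S x) \<partial>lborel)"
    proof (rule nn_integral_mono)
      fix x
      show "epowr (ennreal (covector_norm r (primitive x))) p * indicator S x
        \<le> ennreal ((1 / measure lborel K) powr p) * (epowr (a x) p * indicator S x)"
        using epowr_mono[OF p(1) pw[of x]] K(3) p by (cases "x \<in> S") (auto simp: epowr_mult)
    qed
    also have "\<dots> = ennreal ((1 / measure lborel K) powr p) * (\<integral>\<^sup>+x. epowr (a x) p * indicator S x \<partial>lborel)"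
      by (rule nn_integral_cmult) measurable
    also have "\<dots> \<le> ennreal ((1 / measure lborel K) powr p) * ennreal ((measure lborel K * c) powr p)"
      by (intro mult_left_mono K(4)) auto
    also have "\<dots> = ennreal (c powr p)"
      using K(3) c0 by (simp add: ennreal_mult[symmetric] powr_mult[symmetric])
    finally show ?thesis .
  qed
  have "Lp_norm p r D primitive \<le> epowr (ennreal (c powr p)) (1 / p)"
    unfolding Lp_norm_eq_epowr using p by (intro epowr_mono bound) auto
  also have "\<dots> = ennreal c" using c0 p by (simp add: powr_powr)
  also have "\<dots> \<le> ennreal (vol powr (1 / p - 1 / q) * Cconst p q r DIM('a) * diameter D * N powr (1 / q))"
    unfolding c_def using diameter_subset[OF SD D(2)] C0
    by (intro ennreal_leI mult_right_mono mult_left_mono) auto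
  also have "\<dots> = ennreal (vol powr (1 / p - 1 / q) * Cconst p q r DIM('a) * diameter D) * Lp_norm q (Suc r) D \<alpha>"
    unfolding Lq using C0 diameter_ge_0[OF D(2)] by (intro ennreal_mult) auto
  finally show ?thesis using smooth deriv unfolding vol_def \<alpha>_def by blast
qed

text \<open>Jensen with exponent q/p for |\<xi>|^p, weighted by the indicator of the
  interior.\<close>

lemma Lp_norm_mono_exponent:
  fixes D :: "'a::euclidean_space set" and \<xi> :: "'a form"
  assumes pq: "p \<ge> 1" "p < q" and D: "convex D" "bounded D" "measure lebesgue D > 0"
    and \<xi>: "smooth_form_on r D \<xi>"
  shows "Lp_norm p r D \<xi> \<le> ennreal (measure lebesgue D powr (1 / p - 1 / q)) * Lp_norm q r D \<xi>"
proof -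
  obtain U where U: "open U" "D \<subseteq> U" "\<And>vs k. Ck_on k U (\<lambda>x. \<xi> x vs)"
    using smooth_form_onE[OF \<xi>] by metis
  define S where "S = interior D"
  define V where "V = measure lebesgue D"
  have S: "open S" "S \<subseteq> U" unfolding S_def using U(2) interior_subset by auto
  have [measurable]: "S \<in> sets borel" using S by auto
  have "emeasure lebesgue D = emeasure lborel S"
    using nn_integral_convex_interior[OF D(1), of "\<lambda>_. 1"] S(1) measurable_convex[OF D(1,2)]
    by (simp add: S_def fmeasurable_def)
  moreover have "emeasure lebesgue D = ennreal V"
    unfolding V_def using measurable_convex[OF D(1,2)] by (simp add: emeasure_eq_measure2)
  ultimately have V: "emeasure lborel S = ennreal V" "V > 0" using D(3) by (simp_all add: V_def)
  define f where "f x = indicator S x *\<^sub>R covector_norm r (\<xi> x)" for x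
  have [measurable]: "f \<in> borel_measurable borel"
    unfolding f_def using S(1) Ck_on_continuous[OF U(3)] continuous_on_subset[OF _ S(2)]
    by (intro borel_measurable_continuous_on_indicator continuous_on_covector_norm) auto
  have f0: "f x \<ge> 0" for x by (simp add: f_def covector_norm_nonneg)
  have I: "(\<integral>\<^sup>+x\<in>D. ennreal (covector_norm r (\<xi> x) powr s) \<partial>lebesgue)
      = (\<integral>\<^sup>+x. ennreal (f x powr s) * ennreal (indicator S x) \<partial>lborel)" for s
    unfolding nn_integral_convex_interior[OF D(1)] S_def[symmetric] f_def
    by (intro nn_integral_cong) (auto simp: indicator_def)
  have p: "p > 0" "q > 0" "q / p \<ge> 1" using pq by auto
  have "epowr (\<integral>\<^sup>+x. ennreal (f x powr p) * ennreal (indicator S x) \<partial>lborel) (q / p)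
      \<le> ennreal (V powr (q / p - 1)) * (\<integral>\<^sup>+x. epowr (ennreal (f x powr p)) (q / p) * ennreal (indicator S x) \<partial>lborel)"
    using V p by (intro epowr_nn_integral_le) (auto simp: ennreal_indicator)
  also have "(\<integral>\<^sup>+x. epowr (ennreal (f x powr p)) (q / p) * ennreal (indicator S x) \<partial>lborel)
      = (\<integral>\<^sup>+x. ennreal (f x powr q) * ennreal (indicator S x) \<partial>lborel)"
    using p by (simp add: powr_powr)
  finally have "epowr (epowr (\<integral>\<^sup>+x. ennreal (f x powr p) * ennreal (indicator S x) \<partial>lborel) (q / p)) (1 / q)
      \<le> epowr (ennreal (V powr (q / p - 1)) * (\<integral>\<^sup>+x. ennreal (f x powr q) * ennreal (indicator S x) \<partial>lborel)) (1 / q)"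
    using p by (intro epowr_mono) auto
  moreover have "(V powr (q / p - 1)) powr (1 / q) = V powr (1 / p - 1 / q)"
    using p by (simp add: powr_powr diff_divide_distrib)
  ultimately show ?thesis
    unfolding Lp_norm_eq_epowr I V_def[symmetric] using p by (simp add: epowr_epowr epowr_mult)
qed

theorem theorem2p2:
  fixes D :: "(real ^ 'n) set" and \<omega> :: "(real ^ 'n) form" and r :: nat and p q :: real
  assumes "p \<ge> 1" and "q \<ge> 1"
    and "(p \<ge> q \<and> 1 / q - 1 / p < 1 / real CARD('n)) \<or> p < q"
    and "convex D" and "bounded D"
    and "smooth_form_on r D \<omega>"
  shows "\<exists>\<xi>. smooth_form_on r D \<xi> \<and>
             (\<forall>x\<in>D. ext_deriv \<omega> x = ext_deriv \<xi> x) \<and>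
             Lp_norm p r D \<xi>
               \<le> ennreal (measure lebesgue D powr (1 / p - 1 / q) * Cconst p q r CARD('n) * diameter D)
                 * Lp_norm q (Suc r) D (ext_deriv \<omega>)"
proof -
  let ?V = "measure lebesgue D" and ?C = "Cconst p q r CARD('n)"
  \<comment> \<open>In case (ii) a primitive is sought in L^q first: then s = q and the condition on
    the exponents reads 0 < 1/n.\<close>
  define s where "s = max p q"
  have s: "q \<le> s" "1 / q - 1 / s < 1 / real DIM(real ^ 'n)" "s \<ge> 1"
    using assms(1,2,3) by (auto simp: s_def max_def)
  \<comment> \<open>For p < q the second formula of \<open>Cconst\<close> is the first one with q in
    place of p.\<close>
  have C: "?C = Cconst s q r DIM(real ^ 'n)"
    using assms(3) by (auto simp: s_def max_def Cconst_def)
  have C0: "?C > 0"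
    unfolding C using cone_weight_integral(2)[OF assms(2) s(1) _ s(2)] by simp
  consider "?V = 0" | "?V > 0" "Lp_norm q (Suc r) D (ext_deriv \<omega>) = \<infinity>"
    | "?V > 0" "Lp_norm q (Suc r) D (ext_deriv \<omega>) \<noteq> \<infinity>"
    by (metis zero_less_measure_iff)
  then show ?thesis
  proof cases
    \<comment> \<open>A convex set of volume zero has empty interior, so every form has norm 0 on it
      and \<xi> = \<omega> works.\<close>
    case 1
    have "interior D = {}"
      using 1 measurable_convex[OF assms(4,5)] negligible_convex_interior[OF assms(4)]
      by (simp add: negligible_iff_measure0)
    then have "Lp_norm p r D \<omega> = 0"
      unfolding Lp_norm_eq_epowr nn_integral_convex_interior[OF assms(4)] by simp
    then show ?thesis using assms(6) by (intro exI[of _ \<omega>]) simp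
  next
    \<comment> \<open>The choice \<xi> = \<omega> needs the right-hand side to be \<infinity>. Since
      0 times \<infinity> is 0 in \<open>ennreal\<close>, the constant must be shown positive; a
      ball in \<open>D\<close> gives a positive diameter.\<close>
    case 2
    have "interior D \<noteq> {}"
      using 2 measurable_convex[OF assms(4,5)] negligible_convex_interior[OF assms(4)]
      by (auto simp: negligible_iff_measure0)
    then obtain x e where xe: "e > 0" "cball x e \<subseteq> D"
      using mem_interior_cball by blast
    have "diameter (cball x e) \<le> diameter D" by (rule diameter_subset[OF xe(2) assms(5)])
    then have "diameter D > 0" using xe(1) by simp
    define c where "c = ?V powr (1 / p - 1 / q) * ?C * diameter D"
    have "c > 0" using 2 C0 \<open>diameter D > 0\<close> by (simp add: c_def)
    then show ?thesis
      unfolding c_def[symmetric] using assms(6) 2 by (intro exI[of _ \<omega>]) (simp add: ennreal_mult_top)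
  next
    case 3
    obtain \<xi> where \<xi>: "smooth_form_on r D \<xi>" "\<forall>x\<in>D. ext_deriv \<omega> x = ext_deriv \<xi> x"
      "Lp_norm s r D \<xi> \<le> ennreal (?V powr (1 / s - 1 / q) * ?C * diameter D) * Lp_norm q (Suc r) D (ext_deriv \<omega>)"
      using primitive_estimate[OF assms(2) s(1,2) assms(4,5) 3(1) assms(6) 3(2)] unfolding C by blast
    show ?thesis
    proof (cases "p \<ge> q")
      case True
      then show ?thesis using \<xi> by (auto simp: s_def max_absorb1)
    next
      case False
      then have sq: "s = q" by (simp add: s_def)
      have "Lp_norm p r D \<xi> \<le> ennreal (?V powr (1 / p - 1 / q)) * Lp_norm q r D \<xi>"
        using False by (intro Lp_norm_mono_exponent assms(1,4,5) 3(1) \<xi>(1)) auto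
      \<comment> \<open>For s = q the volume factor of the estimate is V^0 = 1, as V > 0; the whole
        power of the volume comes from lowering the exponent from q to p.\<close>
      also have "\<dots> \<le> ennreal (?V powr (1 / p - 1 / q)) *
          (ennreal (?C * diameter D) * Lp_norm q (Suc r) D (ext_deriv \<omega>))"
        using \<xi>(3) 3(1) unfolding sq by (intro mult_left_mono) auto
      also have "\<dots> = ennreal (?V powr (1 / p - 1 / q) * ?C * diameter D) * Lp_norm q (Suc r) D (ext_deriv \<omega>)"
        using C0 diameter_ge_0[OF assms(5)] by (simp add: ennreal_mult mult.assoc)
      finally show ?thesis using \<xi> by blast
    qed
  qed
qed

end
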